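(* Let $\alpha,\beta>-1$, $0<k<\beta+1$, $\ell\in\mathbb N$, and let $D$ and $W$ be the differential operator and the weight matrix given in the context. For each $w\in\mathbb N_0$ and $0\le j\le\ell$ let $P_w^j$ be the $\mathbb C^{\ell+1}$-valued polynomial constructed in the context, and let $P_w(u)$ be the $(\ell+1)\times(\ell+1)$ matrix whose rows are the vectors $P_w^j(u)$, $j=0,\dots,\ell$ (i.e. the columns of $P_w^*(u)$ are $P_w^0(u),\dots,P_w^\ell(u)$). Then $\{P_w\}_{w\in\mathbb N_0}$ is an orthogonal sequence of matrix valued polynomials with respect to $W$, and $$DP_w^*(u)=P_w^*(u)\Lambda_w\quad\text{for all } w\in\mathbb N_0,\qquad \Lambda_w=\sum_{j=0}^\ell\lambda_j(w)E_{jj}.$$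
   Context: Matrices are $(\ell+1)\times(\ell+1)$ with rows and columns indexed by $0,\dots,\ell$; $E_{ij}$ is the matrix with $(i,j)$ entry $1$ and all other entries $0$; terms with an index outside $\{0,\dots,\ell\}$ are zero. $\mathbb N=\{1,2,\dots\}$, $\mathbb N_0=\mathbb N\cup\{0\}$; $(z)_r=z(z+1)\cdots(z+r-1)$, $(z)_0=1$; $\binom{x}{m}=x(x-1)\cdots(x-m+1)/m!$ for real $x$ and $m\in\mathbb N_0$. $A^*$ is the conjugate transpose and $P^*(u)=P(u)^*$ for real $u$. The operator $D$, acting on vector or matrix valued functions with coefficients multiplying on the left, is $$D=u(1-u)\frac{d^2}{du^2}+(C-uU)\frac{d}{du}-V,$$ $$C=\sum_{i=0}^\ell(\beta+1+2i)E_{ii}+\sum_{i=1}^\ell iE_{i,i-1},\qquad U=\sum_{i=0}^\ell(\alpha+\beta+\ell+i+2)E_{ii},$$ $$V=\sum_{i=0}^\ell i(\alpha+\beta+i-k+1)E_{ii}-\sum_{i=0}^{\ell-1}(\ell-i)(i+\beta-k+1)E_{i,i+1}.$$ The weight is $W(u)=(1-u)^\alpha u^\beta Z(u)$ on $(0,1)$, with $$Z(u)=\sum_{i,j=0}^\ell\Big(\sum_{r=0}^\ell\binom ri\binom rj\binom{\ell+k-r-1}{\ell-r}\binom{\beta-k+r}{r}(1-u)^{\ell-r}u^{i+j}\Big)E_{ij}.$$ For matrix valued polynomials put $(P,Q)=\int_0^1P(u)W(u)Q^*(u)\,du$. A sequence $\{P_w\}_{w\ge0}$ of matrix valued polynomials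 is an orthogonal sequence with respect to $W$ if $P_w$ has degree $w$ with nonsingular leading coefficient and $(P_w,P_{w'})=0$ for $w\ne w'$. Two $\mathbb C^{\ell+1}$-valued polynomials (column vectors) $F,G$ are orthogonal if $\int_0^1G(u)^*W(u)F(u)\,du=0$. For $w\in\mathbb N_0$, $0\le j\le\ell$ put $$\lambda_j(w)=-w(w+\alpha+\beta+\ell+j+1)-j(j+\alpha+\beta-k+1).$$ For $\lambda\in\mathbb C$ define $[C;U;V+\lambda]_0=I$ and $[C;U;V+\lambda]_{i+1}=(C+i)^{-1}\big(i(U+i-1)+V+\lambda\big)[C;U;V+\lambda]_i$ (scalars denote multiples of the identity). Let $V(\lambda)$ be the space of all $\mathbb C^{\ell+1}$-valued polynomials $P$ with $DP=\lambda P$. Construction of $P_w^j$: (1) If $\lambda=\lambda_j(w)$ is not repeated, i.e. $\lambda_{j'}(w')\neq\lambda$ for all $(w',j')\ne(w,j)$, let $F_0\in\mathbb C^{\ell+1}$ be the unique vector with $$[C;U;V+\lambda_j(w)]_wF_0=\sum_{0\le i\le j}(-1)^{i+j}\binom{\ell-i}{\ell-j}\frac{(\beta-k+1+i)_{j-i}}{(\alpha+\beta+j+i+w-k+1)_{j-i}}\,e_i,$$ where $e_0,\dots,e_\ell$ is the canonical basis, and let $P_w^j(u)=\sum_{i\ge0}\frac{u^i}{i!}[C;U;V+\lambda_j(w)]_iF_0$ (which is a polynomial). (2) If $\lambda$ is repeated, list all pairs $(w_1,j_1),\dots,(w_s,j_s)$ with $\lambda_{j_r}(w_r)=\lambda$,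 ordered so that $w_1<w_2<\dots<w_s$ (the $w_r$ are distinct). Put $V_r=\{P\in V(\lambda):\deg P\le w_r\}$ and $V_0=\{0\}$. For each $1\le r\le s$ let $P_{w_r}^{j_r}$ be a nonzero element of $V_r$ orthogonal to $V_{r-1}$. *)

theory Defs
  imports "HOL-Analysis.Analysis" "Jordan_Normal_Form.Schur_Decomposition"
begin

text \<open>
  Matrices and vectors are those of \<^theory>\<open>Jordan_Normal_Form.Matrix\<close>, of dimension
  \<open>l + 1\<close> with indices \<open>0, \<dots>, l\<close>. Vector valued and matrix valued polynomials are vectors and
  matrices with entries in \<^typ>\<open>complex poly\<close>. The parameters \<open>a\<close>, \<open>b\<close>, \<open>k\<close>, \<open>l\<close> stand for
  \<open>\<alpha>\<close>, \<open>\<beta>\<close>, \<open>k\<close>, \<open>\<ell>\<close>.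
\<close>

section \<open>The differential operator\<close>

definition Cmat :: "real \<Rightarrow> nat \<Rightarrow> complex mat" where
  "Cmat b l = Matrix.mat (l + 1) (l + 1) (\<lambda>(i, j). of_real
     (if i = j then b + 1 + 2 * real i else if i = j + 1 then real i else 0))"

definition Umat :: "real \<Rightarrow> real \<Rightarrow> nat \<Rightarrow> complex mat" where
  "Umat a b l = mat_diag (l + 1) (\<lambda>i. of_real (a + b + real l + real i + 2))"

definition Vmat :: "real \<Rightarrow> real \<Rightarrow> real \<Rightarrow> nat \<Rightarrow> complex mat" where
  "Vmat a b k l = Matrix.mat (l + 1) (l + 1) (\<lambda>(i, j). of_real
     (if i = j then real i * (a + b + real i - k + 1)
      else if j = i + 1 then - ((real l - real i) * (real i + b - k + 1)) else 0))"

definition const_mat :: "complex mat \<Rightarrow> complex poly mat" where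
  "const_mat A = map_mat (\<lambda>x. [:x:]) A"

text \<open>The polynomials \<open>u(1 - u)\<close> and \<open>C - uU\<close>; \<open>[:0, 1:]\<close> is the variable \<open>u\<close>.\<close>

definition lead_op :: "complex poly" where
  "lead_op = [:0, 1:] * (1 - [:0, 1:])"

definition first_op :: "real \<Rightarrow> real \<Rightarrow> nat \<Rightarrow> complex poly mat" where
  "first_op a b l = const_mat (Cmat b l) - [:0, 1:] \<cdot>\<^sub>m const_mat (Umat a b l)"

definition D_vec :: "real \<Rightarrow> real \<Rightarrow> real \<Rightarrow> nat \<Rightarrow> complex poly Matrix.vec \<Rightarrow> complex poly Matrix.vec" where
  "D_vec a b k l P =
     lead_op \<cdot>\<^sub>v map_vec (pderiv ^^ 2) P + first_op a b l *\<^sub>v map_vec pderiv P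
       - const_mat (Vmat a b k l) *\<^sub>v P"

definition D_mat :: "real \<Rightarrow> real \<Rightarrow> real \<Rightarrow> nat \<Rightarrow> complex poly mat \<Rightarrow> complex poly mat" where
  "D_mat a b k l P =
     lead_op \<cdot>\<^sub>m map_mat (pderiv ^^ 2) P + first_op a b l * map_mat pderiv P
       - const_mat (Vmat a b k l) * P"

section \<open>The weight and orthogonality\<close>

definition Zmat :: "real \<Rightarrow> real \<Rightarrow> nat \<Rightarrow> real \<Rightarrow> complex mat" where
  "Zmat b k l u = Matrix.mat (l + 1) (l + 1) (\<lambda>(i, j). of_real
     (\<Sum>r\<le>l. real (r choose i) * real (r choose j)
        * ((real l + k - real r - 1) gchoose (l - r)) * ((b - k + real r) gchoose r)
        * (1 - u) ^ (l - r) * u ^ (i + j)))"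

definition Wmat :: "real \<Rightarrow> real \<Rightarrow> real \<Rightarrow> nat \<Rightarrow> real \<Rightarrow> complex mat" where
  "Wmat a b k l u = of_real ((1 - u) powr a * u powr b) \<cdot>\<^sub>m Zmat b k l u"

definition eval_vec :: "complex poly Matrix.vec \<Rightarrow> real \<Rightarrow> complex Matrix.vec" where
  "eval_vec P u = map_vec (\<lambda>p. poly p (of_real u)) P"

definition eval_mat :: "complex poly mat \<Rightarrow> real \<Rightarrow> complex mat" where
  "eval_mat P u = map_mat (\<lambda>p. poly p (of_real u)) P"

text \<open>The integrals below are absolutely convergent for \<open>a, b > -1\<close>, so the value that the Bochner
  integral assigns to non-integrable functions is never used. The matrix integral is entrywise.\<close>

definition mat_pairing ::
    "real \<Rightarrow> real \<Rightarrow> real \<Rightarrow> nat \<Rightarrow> complex poly mat \<Rightarrow> complex poly mat \<Rightarrow> complex mat" where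
  "mat_pairing a b k l P Q = Matrix.mat (l + 1) (l + 1) (\<lambda>ij.
     LINT u:{0<..<1}|lborel. (eval_mat P u * Wmat a b k l u * mat_adjoint (eval_mat Q u)) $$ ij)"

text \<open>\<open>(W F) \<bullet>c G\<close> is \<open>G\<^sup>* W F\<close>.\<close>

definition orthogonal_vec ::
    "real \<Rightarrow> real \<Rightarrow> real \<Rightarrow> nat \<Rightarrow> complex poly Matrix.vec \<Rightarrow> complex poly Matrix.vec \<Rightarrow> bool" where
  "orthogonal_vec a b k l F G \<longleftrightarrow>
     (LINT u:{0<..<1}|lborel. (Wmat a b k l u *\<^sub>v eval_vec F u) \<bullet>c eval_vec G u) = 0"

definition coeff_mat :: "complex poly mat \<Rightarrow> nat \<Rightarrow> complex mat" where
  "coeff_mat P n = map_mat (\<lambda>p. coeff p n) P"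

definition has_degree_mat :: "nat \<Rightarrow> complex poly mat \<Rightarrow> nat \<Rightarrow> bool" where
  "has_degree_mat l P w \<longleftrightarrow>
     coeff_mat P w \<noteq> 0\<^sub>m (l + 1) (l + 1) \<and> (\<forall>n>w. coeff_mat P n = 0\<^sub>m (l + 1) (l + 1))"

definition orthogonal_sequence ::
    "real \<Rightarrow> real \<Rightarrow> real \<Rightarrow> nat \<Rightarrow> (nat \<Rightarrow> complex poly mat) \<Rightarrow> bool" where
  "orthogonal_sequence a b k l P \<longleftrightarrow>
     (\<forall>w. P w \<in> carrier_mat (l + 1) (l + 1) \<and> has_degree_mat l (P w) w
          \<and> invertible_mat (coeff_mat (P w) w))
     \<and> (\<forall>w w'. w \<noteq> w' \<longrightarrow> mat_pairing a b k l (P w) (P w') = 0\<^sub>m (l + 1) (l + 1))"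

section \<open>The polynomials \<open>P\<^sub>w\<^sup>j\<close>\<close>

definition eigval :: "real \<Rightarrow> real \<Rightarrow> real \<Rightarrow> nat \<Rightarrow> nat \<Rightarrow> nat \<Rightarrow> real" where
  "eigval a b k l j w =
     - real w * (real w + a + b + real l + real j + 1) - real j * (real j + a + b - k + 1)"

text \<open>\<open>CUV a b k l z i\<close> is \<open>[C; U; V + z]\<^sub>i\<close>.\<close>

primrec CUV :: "real \<Rightarrow> real \<Rightarrow> real \<Rightarrow> nat \<Rightarrow> complex \<Rightarrow> nat \<Rightarrow> complex mat" where
  "CUV a b k l z 0 = 1\<^sub>m (l + 1)"
| "CUV a b k l z (Suc i) =
     the (mat_inverse (Cmat b l + of_nat i \<cdot>\<^sub>m 1\<^sub>m (l + 1)))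
     * (of_nat i \<cdot>\<^sub>m (Umat a b l + (of_nat i - 1) \<cdot>\<^sub>m 1\<^sub>m (l + 1))
          + Vmat a b k l + z \<cdot>\<^sub>m 1\<^sub>m (l + 1))
     * CUV a b k l z i"

definition eigenspace_poly :: "real \<Rightarrow> real \<Rightarrow> real \<Rightarrow> nat \<Rightarrow> complex \<Rightarrow> complex poly Matrix.vec set" where
  "eigenspace_poly a b k l z = {P \<in> carrier_vec (l + 1). D_vec a b k l P = [:z:] \<cdot>\<^sub>v P}"

definition eigenspace_deg_le ::
    "real \<Rightarrow> real \<Rightarrow> real \<Rightarrow> nat \<Rightarrow> complex \<Rightarrow> nat \<Rightarrow> complex poly Matrix.vec set" where
  "eigenspace_deg_le a b k l z n =
     {P \<in> eigenspace_poly a b k l z. \<forall>i<l + 1. degree (P $ i) \<le> n}"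

definition not_repeated :: "real \<Rightarrow> real \<Rightarrow> real \<Rightarrow> nat \<Rightarrow> nat \<Rightarrow> nat \<Rightarrow> bool" where
  "not_repeated a b k l j w \<longleftrightarrow>
     (\<forall>w' j'. j' \<le> l \<and> (w', j') \<noteq> (w, j) \<longrightarrow> eigval a b k l j' w' \<noteq> eigval a b k l j w)"

definition top_vec :: "real \<Rightarrow> real \<Rightarrow> real \<Rightarrow> nat \<Rightarrow> nat \<Rightarrow> nat \<Rightarrow> complex Matrix.vec" where
  "top_vec a b k l j w = Matrix.vec (l + 1) (\<lambda>i. of_real
     (if i \<le> j then
        (-1) ^ (i + j) * real ((l - i) choose (l - j))
        * (pochhammer (b - k + 1 + real i) (j - i)
           / pochhammer (a + b + real j + real i + real w - k + 1) (j - i))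
      else 0))"

definition constructed_simple ::
    "real \<Rightarrow> real \<Rightarrow> real \<Rightarrow> nat \<Rightarrow> nat \<Rightarrow> nat \<Rightarrow> complex poly Matrix.vec \<Rightarrow> bool" where
  "constructed_simple a b k l j w P \<longleftrightarrow>
     (let z = of_real (eigval a b k l j w) in
      \<exists>F0 \<in> carrier_vec (l + 1).
        (\<forall>F \<in> carrier_vec (l + 1). CUV a b k l z w *\<^sub>v F = top_vec a b k l j w \<longleftrightarrow> F = F0)
        \<and> P \<in> carrier_vec (l + 1)
        \<and> (\<forall>i. map_vec (\<lambda>p. coeff p i) P = inverse (fact i) \<cdot>\<^sub>v (CUV a b k l z i *\<^sub>v F0)))"

text \<open>\<open>ps\<close> lists the pairs \<open>(w\<^sub>1, j\<^sub>1), \<dots>, (w\<^sub>s, j\<^sub>s)\<close>, numbered from \<open>0\<close>; so \<open>Vs r\<close> is the space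
  \<open>V\<^sub>r\<close>, and \<open>(w, j) = ps ! r\<close> is the pair with number \<open>r + 1\<close>.\<close>

definition constructed_repeated ::
    "real \<Rightarrow> real \<Rightarrow> real \<Rightarrow> nat \<Rightarrow> nat \<Rightarrow> nat \<Rightarrow> complex poly Matrix.vec \<Rightarrow> bool" where
  "constructed_repeated a b k l j w P \<longleftrightarrow>
     (\<exists>ps r.
        set ps = {(w', j'). j' \<le> l \<and> eigval a b k l j' w' = eigval a b k l j w}
        \<and> sorted_wrt (<) (map fst ps) \<and> r < length ps \<and> ps ! r = (w, j)
        \<and> (let Vs = (\<lambda>r. if r = 0 then {0\<^sub>v (l + 1)}
                 else eigenspace_deg_le a b k l (of_real (eigval a b k l j w)) (fst (ps ! (r - 1))))
           in P \<in> Vs (r + 1) \<and> P \<noteq> 0\<^sub>v (l + 1) \<and> (\<forall>Q \<in> Vs r. orthogonal_vec a b k l P Q)))"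

text \<open>\<open>p w j\<close> is a legitimate choice of \<open>P\<^sub>w\<^sup>j\<close> for all \<open>w\<close> and \<open>j \<le> l\<close>. The choice is not
  unique: the construction leaves nonzero scalars free for repeated eigenvalues.\<close>

definition constructed_family ::
    "real \<Rightarrow> real \<Rightarrow> real \<Rightarrow> nat \<Rightarrow> (nat \<Rightarrow> nat \<Rightarrow> complex poly Matrix.vec) \<Rightarrow> bool" where
  "constructed_family a b k l p \<longleftrightarrow>
     (\<forall>w. \<forall>j\<le>l. if not_repeated a b k l j w then constructed_simple a b k l j w (p w j)
                 else constructed_repeated a b k l j w (p w j))"

definition mat_with_rows :: "nat \<Rightarrow> (nat \<Rightarrow> complex poly Matrix.vec) \<Rightarrow> complex poly mat" where
  "mat_with_rows l v = mat_of_rows (l + 1) (map v [0..<l + 1])"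

text \<open>The coefficientwise adjoint, so that \<open>P\<^sup>*(u) = P(u)\<^sup>*\<close> for real \<open>u\<close>.\<close>

definition poly_adjoint :: "complex poly mat \<Rightarrow> complex poly mat" where
  "poly_adjoint P = map_mat (map_poly cnj) (transpose_mat P)"

definition Lambda_mat :: "real \<Rightarrow> real \<Rightarrow> real \<Rightarrow> nat \<Rightarrow> nat \<Rightarrow> complex mat" where
  "Lambda_mat a b k l w = mat_diag (l + 1) (\<lambda>j. of_real (eigval a b k l j w))"

end

theory Submission
  imports Defs
begin

text \<open>
  The heart of the matter is that the weight becomes diagonal, and the operator becomes a manifestly
  symmetric one, after a substitution. With
  \<open>f\<^sub>r(u) = \<Sum>\<^sub>i (r choose i) u\<^sup>i F\<^sub>i(u)\<close> the definition of \<open>Z\<close> reads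
  \<open>G\<^sup>* W F = \<Sum>\<^sub>r c\<^sub>r (1-u)\<^bsup>\<alpha>+\<ell>-r\<^esup> u\<^sup>\<beta> f\<^sub>r cnj(g\<^sub>r)\<close>, where
  \<open>c\<^sub>r > 0\<close> because \<open>0 < k < \<beta> + 1\<close>; so the pairing is a positive definite Hermitian form on vector
  polynomials. In these coordinates \<open>D\<close> has a scalar Jacobi operator in each component \<open>r\<close>, and its
  only coupling is a zeroth order difference operator in \<open>r\<close> (lemma \<open>binom_tr_D_seq\<close>). Integration by
  parts in \<open>u\<close> and summation by parts in \<open>r\<close> turn \<open>-(D F, G)\<close> into a Dirichlet form (lemma
  \<open>bform_D_Dirichlet\<close>) that is symmetric in \<open>F\<close> and \<open>G\<close>. No boundary terms have to be examined:
  for polynomials, integration by parts is the recursion of the Beta function.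

  \<open>D\<close> does not raise degrees, and on coefficients of \<open>u\<^sup>w\<close> it acts by a triangular matrix with
  the diagonal entries \<open>\<lambda>\<^sub>0(w), \<dots>, \<lambda>\<^sub>\<ell>(w)\<close>. These are distinct, and the eigenvector for
  \<open>\<lambda>\<^sub>j(w)\<close> is the vector prescribed in the construction. Subtract from \<open>u\<^sup>w\<close> times this vector its
  orthogonal projection to the polynomials of degree less than \<open>w\<close>. By symmetry of \<open>D\<close>, the result
  \<open>P\<close> is an eigenfunction: \<open>D P - \<lambda>\<^sub>j(w) P\<close> has degree less than \<open>w\<close> and is orthogonal to all such
  polynomials (lemma \<open>eigenfunction_exists\<close>). So every pair \<open>(w, j)\<close> has an eigenfunction, and both
  cases of the construction have solutions.

  Conversely, let \<open>P\<close> be any polynomial that the construction allows for \<open>(w, j)\<close>. It is an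
  eigenfunction of degree at most \<open>w\<close>, and its coefficient of \<open>u\<^sup>w\<close> is a multiple of the eigenvector.
  The multiple is not zero. For a simple eigenvalue this is built in. For a repeated one, \<open>P\<close> would
  otherwise have as degree one of the smaller \<open>w\<^sub>r\<close>, hence lie in the space to which it is orthogonal.
  The eigenvectors form a triangular matrix with ones on the diagonal, so the leading coefficient of
  \<open>P\<^sub>w\<close> is nonsingular. Rows for different \<open>w\<close> are orthogonal by symmetry of \<open>D\<close> if their eigenvalues
  differ, and by construction if they agree.
\<close>

(* smult is the scalar multiplication of polynomials throughout *)
hide_const (open) Module.smult

section \<open>Integration of polynomials against the Jacobi weight\<close>

definition jacobi_int :: "real \<Rightarrow> real \<Rightarrow> complex poly \<Rightarrow> complex" where
  "jacobi_int A B p =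
     (LINT u:{0<..<1}|lborel. of_real ((1 - u) powr A * u powr B) * poly p (of_real u))"

lemma monomial_jacobi_integral:
  fixes A B :: real
  assumes "A > -1" "B > -1"
  shows "set_integrable lborel {0<..<1} (\<lambda>u. (1 - u) powr A * u powr B * u ^ n)"
    and "(LINT u:{0<..<1}|lborel. (1 - u) powr A * u powr B * u ^ n) = Beta (B + 1 + n) (A + 1)"
proof -
  let ?f = "\<lambda>t::real. t powr (B + 1 + n - 1) * (1 - t) powr (A + 1 - 1)"
  have pos: "B + 1 + n > 0" "A + 1 > 0"
    using assms by auto
  have int: "set_integrable lborel {0<..<1} ?f"
    by (rule set_integrable_subset[OF integrable_Beta[OF pos]]) auto
  have eq: "?f u = (1 - u) powr A * u powr B * u ^ n" if "u \<in> {0<..<1}" for u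
    using that powr_add[of u B "real n"] powr_realpow[of u n] by simp
  show "set_integrable lborel {0<..<1} (\<lambda>u. (1 - u) powr A * u powr B * u ^ n)"
    using int set_integrable_cong[of lborel lborel "{0<..<1}" "{0<..<1}" ?f, OF refl refl eq] by blast
  have "(LINT u:{0<..<1}|lborel. (1 - u) powr A * u powr B * u ^ n) = (LINT u:{0<..<1}|lborel. ?f u)"
    by (rule set_lebesgue_integral_cong) (auto simp only: eq sets_lborel borel_open open_greaterThanLessThan)
  also have "\<dots> = integral {0<..<1} ?f"
    by (rule set_borel_integral_eq_integral[OF int])
  also have "\<dots> = integral {0..1} ?f"
    by (rule integral_open_interval_real[symmetric])
  also have "\<dots> = Beta (B + 1 + n) (A + 1)"
    using has_integral_Beta_real[OF pos] by (rule integral_unique)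
  finally show "(LINT u:{0<..<1}|lborel. (1 - u) powr A * u powr B * u ^ n) = Beta (B + 1 + n) (A + 1)" .
qed

lemma monomial_jacobi_integral_complex:
  fixes A B :: real
  assumes "A > -1" "B > -1"
  shows "set_integrable lborel {0<..<1} (\<lambda>u. of_real ((1 - u) powr A * u powr B) * (of_real u ^ n :: complex))"
    and "(LINT u:{0<..<1}|lborel. of_real ((1 - u) powr A * u powr B) * (of_real u ^ n :: complex))
       = of_real (Beta (B + 1 + n) (A + 1))"
proof -
  have "set_integrable lborel {0<..<1} (\<lambda>u. of_real ((1 - u) powr A * u powr B * u ^ n) :: complex)"
    using monomial_jacobi_integral(1)[OF assms] unfolding set_integrable_def
    by (simp flip: of_real_mult add: scaleR_conv_of_real complex_of_real_integrable_eq)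
  then show "set_integrable lborel {0<..<1} (\<lambda>u. of_real ((1 - u) powr A * u powr B) * (of_real u ^ n :: complex))"
    by simp
  have "(LINT u:{0<..<1}|lborel. of_real ((1 - u) powr A * u powr B * u ^ n) :: complex)
      = of_real (LINT u:{0<..<1}|lborel. (1 - u) powr A * u powr B * u ^ n)"
    by (rule set_integral_complex_of_real)
  then show "(LINT u:{0<..<1}|lborel. of_real ((1 - u) powr A * u powr B) * (of_real u ^ n :: complex))
       = of_real (Beta (B + 1 + n) (A + 1))"
    by (simp add: monomial_jacobi_integral(2)[OF assms])
qed

lemma jacobi_integrable:
  assumes "A > -1" "B > -1"
  shows "set_integrable lborel {0<..<1}
    (\<lambda>u. of_real ((1 - u) powr A * u powr B) * poly p (of_real u :: complex))"
proof -
  have "set_integrable lborel {0<..<1}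
     (\<lambda>u. \<Sum>i\<le>degree p. coeff p i * (of_real ((1 - u) powr A * u powr B) * (of_real u :: complex) ^ i))"
    unfolding set_integrable_def scaleR_sum_right
    by (intro Bochner_Integration.integrable_sum
      set_integrable_mult_right[OF monomial_jacobi_integral_complex(1)[OF assms], unfolded set_integrable_def])
  then show ?thesis
    by (simp add: poly_altdef sum_distrib_left mult_ac)
qed

lemma jacobi_int_add:
  assumes "A > -1" "B > -1"
  shows "jacobi_int A B (p + q) = jacobi_int A B p + jacobi_int A B q"
  using set_integral_add(2)[OF jacobi_integrable[OF assms, of p] jacobi_integrable[OF assms, of q]]
  by (simp add: jacobi_int_def distrib_left)

lemma jacobi_int_smult: "jacobi_int A B (smult c p) = c * jacobi_int A B p"
proof -
  have "jacobi_int A B (smult c p) =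
      (LINT u:{0<..<1}|lborel. c * (of_real ((1 - u) powr A * u powr B) * poly p (of_real u)))"
    by (simp add: jacobi_int_def mult_ac)
  then show ?thesis
    by (simp only: set_integral_mult_right jacobi_int_def)
qed

lemma jacobi_int_0 [simp]: "jacobi_int A B 0 = 0"
  using jacobi_int_smult[of A B 0 0] by simp

lemma jacobi_int_minus: "jacobi_int A B (- p) = - jacobi_int A B p"
  using jacobi_int_smult[of A B "-1" p] by simp

lemma jacobi_int_cnj: "jacobi_int A B (map_poly cnj p) = cnj (jacobi_int A B p)"
proof -
  have "indicat_real {0<..<1} u *\<^sub>R (of_real ((1 - u) powr A * u powr B) * poly (map_poly cnj p) (of_real u))
      = cnj (indicat_real {0<..<1} u *\<^sub>R (of_real ((1 - u) powr A * u powr B) * poly p (of_real u)))" for u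
    by (simp add: scaleR_conv_of_real)
  then show ?thesis
    unfolding jacobi_int_def set_lebesgue_integral_def by (simp only: Bochner_Integration.integral_cnj)
qed

lemma map_poly_cnj_mult: "map_poly cnj (p * q) = map_poly cnj p * map_poly cnj q"
  by (rule poly_ext) simp

lemma jacobi_int_diff:
  assumes "A > -1" "B > -1"
  shows "jacobi_int A B (p - q) = jacobi_int A B p - jacobi_int A B q"
  using jacobi_int_add[OF assms, of p "- q"] by (simp add: jacobi_int_minus)

lemma jacobi_int_monom:
  assumes "A > -1" "B > -1"
  shows "jacobi_int A B (monom 1 n) = of_real (Beta (B + 1 + n) (A + 1))"
  using monomial_jacobi_integral_complex(2)[OF assms] by (simp add: jacobi_int_def poly_monom)

lemma jacobi_int_raise: "jacobi_int (A + 1) B p = jacobi_int A B ([:1, -1:] * p)"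
  unfolding jacobi_int_def
  by (rule set_lebesgue_integral_cong) (auto simp: powr_add algebra_simps)

lemma poly_monom_induct [consumes 0, case_names add smult monom]:
  assumes "\<And>p q. P p \<Longrightarrow> P q \<Longrightarrow> P (p + q)" "\<And>c p. P p \<Longrightarrow> P (smult c p)" "\<And>n. P (monom 1 n)"
  shows "P (p :: complex poly)"
proof -
  have m: "P (monom c n)" for c n
    using assms(2)[OF assms(3)[of n], of c] by (simp add: smult_monom)
  have "P (\<Sum>i\<in>I. monom (coeff p i) i)" if "finite I" for I
    using that by induction (use m[of 0 0] in \<open>auto intro: assms(1) m\<close>)
  from this[of "{..degree p}"] show ?thesis
    by (simp add: poly_as_sum_of_monoms)
qed

text \<open>Formally the integrand is \<open>((1-u)\<^bsup>A+1\<^esup> u\<^bsup>B+1\<^esup> h)\<^sup>\<prime>\<close>, which vanishes at both ends. For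
  \<open>h = u\<^sup>n\<close> the claim is the recursion \<open>x B(x, y) = (x + y) B(x + 1, y)\<close>, so it needs no limits at
  the endpoints.\<close>

lemma jacobi_int_exact:
  assumes "A > -1" "B > -1"
  shows "jacobi_int A B (lead_op * pderiv h + [:of_real (B + 1), - of_real (A + B + 2):] * h) = 0"
    (is "jacobi_int A B (?e h) = 0")
proof (induction h rule: poly_monom_induct)
  case (add p q)
  have "?e (p + q) = ?e p + ?e q"
    by (simp only: pderiv_add distrib_left add_ac)
  then have "jacobi_int A B (?e (p + q)) = jacobi_int A B (?e p) + jacobi_int A B (?e q)"
    by (simp only: jacobi_int_add[OF assms])
  with add show ?case
    by (simp only: add_0)
next
  case (smult c p)
  have "?e (smult c p) = smult c (?e p)"
    by (simp only: pderiv_smult mult_smult_right smult_add_right)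
  with smult show ?case
    by (simp only: jacobi_int_smult mult_zero_right)
next
  case (monom n)
  let ?x = "B + 1 + real n"
  have eq: "?e (monom 1 n) = smult (of_real ?x) (monom 1 n) - smult (of_real (?x + A + 1)) (monom 1 (Suc n))"
  proof (cases n)
    case 0
    then show ?thesis
      by (simp add: lead_op_def pderiv_monom monom_0 monom_Suc)
  next
    case (Suc m)
    show ?thesis
      by (rule poly_ext) (simp add: Suc lead_op_def pderiv_monom poly_monom algebra_simps)
  qed
  have "?x * Beta ?x (A + 1) = (?x + (A + 1)) * Beta (?x + 1) (A + 1)"
    by (rule Beta_plus1_left[symmetric]) (use assms in \<open>auto elim!: nonpos_Ints_cases\<close>)
  then have "complex_of_real (?x * Beta ?x (A + 1)) = of_real ((?x + (A + 1)) * Beta (?x + 1) (A + 1))"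
    by (simp only:)
  moreover have "?x + 1 = B + 1 + real (Suc n)"
    by simp
  ultimately show ?case
    unfolding eq
    by (simp only: jacobi_int_diff[OF assms] jacobi_int_smult jacobi_int_monom[OF assms] of_real_mult add.assoc diff_self)
qed

text \<open>A nonnegative integrand with integral zero vanishes almost everywhere, but a nonzero polynomial has
  only finitely many zeros.\<close>

lemma jacobi_int_square:
  assumes "A > -1" "B > -1"
  shows "\<exists>x\<ge>0. jacobi_int A B (p * map_poly cnj p) = of_real x \<and> (x = 0 \<longrightarrow> p = 0)"
proof -
  let ?f = "\<lambda>u::real. (1 - u) powr A * u powr B * (cmod (poly p (of_real u)))\<^sup>2"
  have eq: "of_real ((1 - u) powr A * u powr B) * poly (p * map_poly cnj p) (of_real u) = complex_of_real (?f u)" for u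
    by (simp add: complex_norm_square del: of_real_power)
  define x where "x = (LINT u:{0<..<1}|lborel. ?f u)"
  have "jacobi_int A B (p * map_poly cnj p) = of_real x"
    unfolding jacobi_int_def eq x_def by (rule set_integral_complex_of_real)
  moreover have nonneg: "x \<ge> 0"
    unfolding x_def set_lebesgue_integral_def by (rule Bochner_Integration.integral_nonneg) (auto simp: indicator_def)
  moreover have "p = 0" if "x = 0"
  proof (rule ccontr)
    assume "p \<noteq> 0"
    have "set_integrable lborel {0<..<1} (\<lambda>u. complex_of_real (?f u))"
      using jacobi_integrable[OF assms, of "p * map_poly cnj p"] unfolding eq .
    then have int: "set_integrable lborel {0<..<1} ?f"
      unfolding set_integrable_def by (simp add: scaleR_conv_of_real complex_of_real_integrable_eq flip: of_real_mult of_real_power)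
    have "AE u in lborel. indicator {0<..<1} u *\<^sub>R ?f u = 0"
      using int that unfolding x_def set_lebesgue_integral_def set_integrable_def
      by (subst (asm) integral_nonneg_eq_0_iff_AE) (auto simp: indicator_def)
    moreover have "finite {u::real. poly p (of_real u) = 0}"
      using finite_vimageI[OF poly_roots_finite[OF \<open>p \<noteq> 0\<close>], of complex_of_real]
      by (simp add: vimage_def inj_of_real)
    then have "AE u in lborel. u \<notin> {u::real. poly p (of_real u) = 0}"
      by (intro AE_not_in finite_imp_null_set_lborel)
    ultimately have "AE u::real in lborel. u \<notin> {0<..<1}"
      by eventually_elim (auto simp: indicator_def split: if_splits)
    then have "emeasure lborel {0<..<1::real} = 0"
      by (subst (asm) AE_iff_null_sets[symmetric]) auto
    then show False
      by simp
  qed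
  ultimately show ?thesis
    by blast
qed

section \<open>The operator on sequences of polynomials, and the binomial transform\<close>

text \<open>A vector polynomial is represented by the sequence of its components; only the indices up to \<open>l\<close>
  matter. The transform scales component \<open>i\<close> by \<open>u\<^sup>i\<close> and applies the Pascal matrix; this diagonalizes the
  weight.\<close>

definition binom_tr :: "(nat \<Rightarrow> complex poly) \<Rightarrow> nat \<Rightarrow> complex poly" where
  "binom_tr F r = (\<Sum>i\<le>r. smult (of_nat (r choose i)) (monom 1 i * F i))"

lemma binom_tr_add: "binom_tr (\<lambda>i. F i + G i) r = binom_tr F r + binom_tr G r"
  by (simp add: binom_tr_def algebra_simps sum.distrib smult_add_right)

lemma binom_tr_mult: "binom_tr (\<lambda>i. p * F i) r = p * binom_tr F r"
  by (simp add: binom_tr_def sum_distrib_left algebra_simps)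

lemma binom_tr_smult: "binom_tr (\<lambda>i. smult c (F i)) r = smult c (binom_tr F r)"
  using binom_tr_mult[of "[:c:]" F r] by simp

lemma binom_tr_cong: "(\<And>i. i \<le> r \<Longrightarrow> F i = G i) \<Longrightarrow> binom_tr F r = binom_tr G r"
  unfolding binom_tr_def by (intro sum.cong) auto

lemma binom_tr_cnj: "binom_tr (\<lambda>i. map_poly cnj (F i)) r = map_poly cnj (binom_tr F r)"
proof (rule poly_eqI)
  fix n
  have "cnj (coeff (monom 1 i * F i) n) = coeff (monom 1 i * map_poly cnj (F i)) n" for i
    by (simp add: coeff_monom_mult coeff_map_poly)
  then show "coeff (binom_tr (\<lambda>i. map_poly cnj (F i)) r) n = coeff (map_poly cnj (binom_tr F r)) n"
    by (simp add: binom_tr_def coeff_sum coeff_map_poly)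
qed

text \<open>The Pascal matrix is triangular with the diagonal entries \<open>u\<^sup>i\<close>.\<close>

lemma binom_tr_eq_0_imp:
  assumes "\<And>r. r \<le> l \<Longrightarrow> binom_tr F r = 0" "i \<le> l"
  shows "F i = 0"
  using assms(2)
proof (induction i rule: less_induct)
  case (less i)
  have "binom_tr F i = (\<Sum>m\<in>{i}. smult (of_nat (i choose m)) (monom 1 m * F m))"
    unfolding binom_tr_def using less by (intro sum.mono_neutral_right) auto
  then have "monom 1 i * F i = 0"
    using assms(1)[of i] less.prems by simp
  then show ?case
    by (simp add: monom_eq_0_iff)
qed

text \<open>This is \<open>(r - i) (r choose i) = (i + 1) (r choose (i + 1))\<close>. It is what trades a factor \<open>u\<close> for a
  shift of the index, and with it all the terms of the operator can be brought to the same power.\<close>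

lemma binom_tr_shift:
  "[:0, 1:] * binom_tr (\<lambda>i. smult (of_nat (r - i)) (G (Suc i))) r = binom_tr (\<lambda>i. smult (of_nat i) (G i)) r"
proof -
  have "binom_tr (\<lambda>i. smult (of_nat i) (G i)) (Suc r') =
      [:0, 1:] * binom_tr (\<lambda>i. smult (of_nat (Suc r' - i)) (G (Suc i))) (Suc r')" for r'
  proof -
    have "binom_tr (\<lambda>i. smult (of_nat i) (G i)) (Suc r')
        = (\<Sum>i\<le>r'. smult (of_nat (Suc i * (Suc r' choose Suc i))) (monom 1 (Suc i) * G (Suc i)))"
      unfolding binom_tr_def sum.atMost_Suc_shift by (simp add: algebra_simps)
    also have "\<dots> = (\<Sum>i\<le>r'. smult (of_nat ((Suc r' - i) * (Suc r' choose i))) (monom 1 (Suc i) * G (Suc i)))"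
    proof (intro sum.cong refl)
      fix i assume "i \<in> {..r'}"
      then have "Suc i * (Suc r' choose Suc i) = (Suc r' - i) * (Suc r' choose i)"
        by (metis Suc_times_binomial_eq binomial_absorb_comp diff_Suc_Suc diff_Suc_1 mult.commute binomial_absorption)
      then show "smult (of_nat (Suc i * (Suc r' choose Suc i))) (monom 1 (Suc i) * G (Suc i)) =
          smult (of_nat ((Suc r' - i) * (Suc r' choose i))) (monom 1 (Suc i) * G (Suc i))"
        by (simp only:)
    qed
    also have "\<dots> = (\<Sum>i\<le>Suc r'. smult (of_nat ((Suc r' - i) * (Suc r' choose i))) (monom 1 (Suc i) * G (Suc i)))"
      by simp
    also have "\<dots> = [:0, 1:] * binom_tr (\<lambda>i. smult (of_nat (Suc r' - i)) (G (Suc i))) (Suc r')"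
      unfolding binom_tr_def sum_distrib_left by (intro sum.cong refl) (simp add: monom_Suc mult_ac del: of_nat_diff)
    finally show ?thesis .
  qed
  then show ?thesis
    by (cases r) (auto simp: binom_tr_def)
qed

text \<open>Pascal's rule. The difference of consecutive components of the transform is divisible by \<open>u\<close>, which
  is why the quotient by \<open>u\<close> in the coupling terms stays polynomial.\<close>

lemma binom_tr_Suc:
  "binom_tr F (Suc r) = binom_tr F r + [:0, 1:] * binom_tr (\<lambda>i. F (Suc i)) r"
proof -
  have "binom_tr F (Suc r) = F 0 + (\<Sum>i\<le>r. smult (of_nat (Suc r choose Suc i)) (monom 1 (Suc i) * F (Suc i)))"
    unfolding binom_tr_def sum.atMost_Suc_shift by simp
  also have "\<dots> = (F 0 + (\<Sum>i\<le>r. smult (of_nat (r choose Suc i)) (monom 1 (Suc i) * F (Suc i))))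
      + (\<Sum>i\<le>r. smult (of_nat (r choose i)) (monom 1 (Suc i) * F (Suc i)))"
    by (simp add: smult_add_left sum.distrib)
  also have "F 0 + (\<Sum>i\<le>r. smult (of_nat (r choose Suc i)) (monom 1 (Suc i) * F (Suc i)))
      = (\<Sum>i\<le>Suc r. smult (of_nat (r choose i)) (monom 1 i * F i))"
    unfolding sum.atMost_Suc_shift by simp
  also have "\<dots> = binom_tr F r"
    by (simp add: binom_tr_def)
  also have "(\<Sum>i\<le>r. smult (of_nat (r choose i)) (monom 1 (Suc i) * F (Suc i)))
      = [:0, 1:] * binom_tr (\<lambda>i. F (Suc i)) r"
    unfolding binom_tr_def sum_distrib_left by (intro sum.cong refl) (simp add: monom_Suc mult_ac)
  finally show ?thesis .
qed

text \<open>This is \<open>r ((r - 1) choose i) = (r - i) (r choose i)\<close>; for \<open>r = 0\<close> both sides vanish.\<close>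

lemma binom_tr_pred:
  "smult (of_nat r) (binom_tr G (r - 1)) = binom_tr (\<lambda>i. smult (of_nat (r - i)) (G i)) r"
proof (cases r)
  case 0
  then show ?thesis by (simp add: binom_tr_def)
next
  case (Suc m)
  have "smult (of_nat (Suc m)) (binom_tr G m) = (\<Sum>i\<le>m. smult (of_nat (Suc m * (m choose i))) (monom 1 i * G i))"
    unfolding binom_tr_def by (simp add: smult_sum2 algebra_simps)
  also have "\<dots> = (\<Sum>i\<le>m. smult (of_nat ((Suc m - i) * (Suc m choose i))) (monom 1 i * G i))"
    using binomial_absorb_comp[of "Suc m"] by simp
  also have "\<dots> = binom_tr (\<lambda>i. smult (of_nat (Suc m - i)) (G i)) (Suc m)"
    unfolding binom_tr_def by (simp add: mult.commute del: of_nat_diff)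
  finally show ?thesis
    using Suc by simp
qed

text \<open>Multiplied by \<open>u\<close>, the derivative only produces factors \<open>i\<close> in the summands, and \<open>binom_tr_shift\<close>
  divides the \<open>u\<close> out again.\<close>

lemma pderiv_binom_tr:
  "pderiv (binom_tr F r) = binom_tr (\<lambda>i. pderiv (F i) + smult (of_nat (r - i)) (F (Suc i))) r"
proof -
  let ?E = "\<lambda>f. [:0, 1:] * pderiv f"
  have mon: "?E (monom 1 i * p) = monom 1 i * ([:0, 1:] * pderiv p + smult (of_nat i) p)" for i and p :: "complex poly"
  proof (cases i)
    case 0
    then show ?thesis by (simp add: monom_0)
  next
    case (Suc m)
    show ?thesis
      by (rule poly_ext) (simp add: Suc pderiv_mult pderiv_monom poly_monom algebra_simps)
  qed
  have "?E (binom_tr F r) = (\<Sum>i\<le>r. smult (of_nat (r choose i)) (?E (monom 1 i * F i)))"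
    unfolding binom_tr_def pderiv_sum pderiv_smult sum_distrib_left by (simp only: mult_smult_right)
  also have "\<dots> = binom_tr (\<lambda>i. [:0, 1:] * pderiv (F i) + smult (of_nat i) (F i)) r"
    unfolding mon binom_tr_def ..
  also have "\<dots> = [:0, 1:] * binom_tr (\<lambda>i. pderiv (F i) + smult (of_nat (r - i)) (F (Suc i))) r"
    unfolding binom_tr_add binom_tr_mult distrib_left binom_tr_shift ..
  finally show ?thesis
    by (simp only: mult_cancel_left) auto
qed

text \<open>The components of \<open>D F\<close>. The coefficients of \<open>F (i - 1)\<close> for \<open>i = 0\<close> and of \<open>F (Suc i)\<close> for \<open>i = l\<close>
  vanish, so no case distinction at the ends of the index range is needed.\<close>

definition D_seq :: "real \<Rightarrow> real \<Rightarrow> real \<Rightarrow> nat \<Rightarrow> (nat \<Rightarrow> complex poly) \<Rightarrow> nat \<Rightarrow> complex poly" where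
  "D_seq a b k l F i = lead_op * pderiv (pderiv (F i))
     + [:of_real (b + 1 + 2 * real i), - of_real (a + b + real l + real i + 2):] * pderiv (F i)
     + smult (of_nat i) (pderiv (F (i - 1)))
     - smult (of_real (real i * (a + b + real i - k + 1))) (F i)
     + smult (of_real ((real l - real i) * (real i + b - k + 1))) (F (Suc i))"

text \<open>The operator in the new coordinates. Writing \<open>f\<^sub>r\<close> for the transform, the sums over \<open>F (Suc i)\<close> are
  \<open>(f\<^bsub>r+1\<^esub> - f\<^sub>r) / u\<close> and \<open>(f\<^sub>r - f\<^bsub>r-1\<^esub>) / u\<close>. All terms are transforms of sequences that involve
  only \<open>F i\<close>, \<open>F (Suc i)\<close> and derivatives of \<open>F i\<close>, so it suffices to compare them at each \<open>i\<close>.\<close>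

lemma binom_tr_D_seq:
  "binom_tr (D_seq a b k l F) r =
      lead_op * pderiv (pderiv (binom_tr F r))
      + [:of_real (b + 1), - of_real (a + b + real l - real r + 2):] * pderiv (binom_tr F r)
      + smult (of_real ((real l - real r) * (real r + 1 + b - k))) (binom_tr (\<lambda>i. F (Suc i)) r)
      - [:1, -1:] * smult (of_real (real r * (real l - real r + k))) (binom_tr (\<lambda>i. F (Suc i)) (r - 1))"
proof -
  let ?T = "\<lambda>G. binom_tr G r" and ?X = "[:0, 1:] :: complex poly"
  define m where "m = complex_of_real (a + b + real l - real r + 2)"
  define z where "z = complex_of_real (real l - real r + k)"
  have const: "[:c:] * p = smult c p" and neg: "[:-1:] * p = - p" for c and p :: "complex poly"
    by simp_all
  have shift: "?X * ?T (\<lambda>i. smult (of_nat (r - i)) (G (Suc i))) = ?T (\<lambda>i. smult (of_nat i) (G i))" for G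
    by (rule binom_tr_shift)
  have d2: "lead_op * pderiv (pderiv (?T F)) = ?T (\<lambda>i. lead_op * pderiv (pderiv (F i))
      + smult (2 * of_nat i) ([:1, -1:] * pderiv (F i))
      + (smult (of_nat i) (smult (of_nat (r - i)) (F (Suc i))) - smult (of_nat i) (smult (of_nat (i - 1)) (F i))))"
  proof -
    have "pderiv (pderiv (?T F)) = ?T (\<lambda>i. pderiv (pderiv (F i)) + smult (of_nat (r - i)) (smult 2 (pderiv (F (Suc i))))
       + smult (of_nat (r - i)) (smult (of_nat (r - Suc i)) (F (Suc (Suc i)))))"
      unfolding pderiv_binom_tr
      by (rule binom_tr_cong, rule poly_ext) (simp add: pderiv_add pderiv_smult algebra_simps del: of_nat_diff)
    then have "?X * pderiv (pderiv (?T F)) = ?T (\<lambda>i. ?X * pderiv (pderiv (F i)) + smult (of_nat i) (smult 2 (pderiv (F i)))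
       + smult (of_nat i) (smult (of_nat (r - i)) (F (Suc i))))"
      using shift[of "\<lambda>i. smult 2 (pderiv (F i))"] shift[of "\<lambda>i. smult (of_nat (r - i)) (F (Suc i))"]
      by (simp only: binom_tr_add binom_tr_mult distrib_left)
    moreover have "?X * ?T (\<lambda>i. smult (of_nat i) (smult (of_nat (r - i)) (F (Suc i))))
       = ?T (\<lambda>i. smult (of_nat i) (smult (of_nat (i - 1)) (F i)))"
      using shift[of "\<lambda>i. smult (of_nat (i - 1)) (F i)"] by (simp add: mult.commute del: of_nat_diff)
    moreover have "lead_op * pderiv (pderiv (?T F)) = ?X * pderiv (pderiv (?T F)) - ?X * (?X * pderiv (pderiv (?T F)))"
      by (simp add: lead_op_def algebra_simps)
    ultimately have "lead_op * pderiv (pderiv (?T F))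
       = ?T (\<lambda>i. ?X * pderiv (pderiv (F i)) + smult (of_nat i) (smult 2 (pderiv (F i)))
           + smult (of_nat i) (smult (of_nat (r - i)) (F (Suc i))))
         + - 1 * (?T (\<lambda>i. ?X * (?X * pderiv (pderiv (F i)) + smult (of_nat i) (smult 2 (pderiv (F i)))))
             + ?T (\<lambda>i. smult (of_nat i) (smult (of_nat (i - 1)) (F i))))"
      by (simp only: binom_tr_add binom_tr_mult distrib_left) simp
    also have "\<dots> = ?T (\<lambda>i. lead_op * pderiv (pderiv (F i))
      + smult (2 * of_nat i) ([:1, -1:] * pderiv (F i))
      + (smult (of_nat i) (smult (of_nat (r - i)) (F (Suc i))) - smult (of_nat i) (smult (of_nat (i - 1)) (F i))))"
      unfolding binom_tr_add[symmetric] binom_tr_mult[symmetric]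
      by (rule binom_tr_cong, rule poly_ext) (simp add: lead_op_def algebra_simps del: of_nat_diff)
    finally show ?thesis .
  qed
  have d1: "[:of_real (b + 1), - m:] * pderiv (?T F) = ?T (\<lambda>i. [:of_real (b + 1), - m:] * pderiv (F i)
      + (smult (of_real (b + 1)) (smult (of_nat (r - i)) (F (Suc i))) - smult m (smult (of_nat i) (F i))))"
  proof -
    have "[:of_real (b + 1), - m:] * pderiv (?T F) =
        [:of_real (b + 1), - m:] * ?T (\<lambda>i. pderiv (F i))
        + ([:of_real (b + 1):] * ?T (\<lambda>i. smult (of_nat (r - i)) (F (Suc i)))
           + [:- m:] * (?X * ?T (\<lambda>i. smult (of_nat (r - i)) (F (Suc i)))))"
      unfolding pderiv_binom_tr binom_tr_add by (simp add: algebra_simps)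
    also have "\<dots> = ?T (\<lambda>i. [:of_real (b + 1), - m:] * pderiv (F i)
      + (smult (of_real (b + 1)) (smult (of_nat (r - i)) (F (Suc i))) - smult m (smult (of_nat i) (F i))))"
      unfolding shift unfolding binom_tr_mult[symmetric] binom_tr_add[symmetric]
      by (rule binom_tr_cong) (simp add: mult.commute)
    finally show ?thesis .
  qed
  have z: "[:1, -1:] * smult (of_real (real r * (real l - real r + k))) (binom_tr (\<lambda>i. F (Suc i)) (r - 1))
      = ?T (\<lambda>i. smult z (smult (of_nat (r - i)) (F (Suc i)) - smult (of_nat i) (F i)))"
  proof -
    have "[:1, -1:] * smult (of_real (real r * (real l - real r + k))) (binom_tr (\<lambda>i. F (Suc i)) (r - 1))
      = [:z:] * (smult (of_nat r) (binom_tr (\<lambda>i. F (Suc i)) (r - 1)) + - 1 * (?X * smult (of_nat r) (binom_tr (\<lambda>i. F (Suc i)) (r - 1))))"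
      by (rule poly_ext) (simp add: z_def algebra_simps)
    also have "\<dots> = ?T (\<lambda>i. smult z (smult (of_nat (r - i)) (F (Suc i)) - smult (of_nat i) (F i)))"
      unfolding binom_tr_pred shift unfolding binom_tr_mult[symmetric] binom_tr_add[symmetric]
      by (rule binom_tr_cong) simp
    finally show ?thesis .
  qed
  (* the only term of the operator that moves an index down; the shift returns it to F i *)
  have sub: "?T (\<lambda>i. smult (of_nat i) (pderiv (F (i - 1)))) = ?T (\<lambda>i. ?X * smult (of_nat (r - i)) (pderiv (F i)))"
    unfolding binom_tr_mult using shift[of "\<lambda>i. pderiv (F (i - 1))"] by (simp del: of_nat_diff mult_pCons_left)
  let ?H = "\<lambda>i. lead_op * pderiv (pderiv (F i))
     + [:of_real (b + 1 + 2 * real i), - of_real (a + b + real l + real i + 2):] * pderiv (F i)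
     - smult (of_real (real i * (a + b + real i - k + 1))) (F i)
     + smult (of_real ((real l - real i) * (real i + b - k + 1))) (F (Suc i))"
  have "?T (D_seq a b k l F) = ?T ?H + ?T (\<lambda>i. smult (of_nat i) (pderiv (F (i - 1))))"
    unfolding binom_tr_add[symmetric] by (rule binom_tr_cong) (simp add: D_seq_def)
  also have "\<dots> = ?T (\<lambda>i. ?H i + ?X * smult (of_nat (r - i)) (pderiv (F i)))"
    unfolding sub binom_tr_add ..
  also have "\<dots> = ?T (\<lambda>i. (lead_op * pderiv (pderiv (F i))
        + smult (2 * of_nat i) ([:1, -1:] * pderiv (F i))
        + (smult (of_nat i) (smult (of_nat (r - i)) (F (Suc i))) - smult (of_nat i) (smult (of_nat (i - 1)) (F i))))
      + ([:of_real (b + 1), - m:] * pderiv (F i)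
        + (smult (of_real (b + 1)) (smult (of_nat (r - i)) (F (Suc i))) - smult m (smult (of_nat i) (F i))))
      + [:of_real ((real l - real r) * (real r + 1 + b - k)):] * F (Suc i)
      + [:-1:] * smult z (smult (of_nat (r - i)) (F (Suc i)) - smult (of_nat i) (F i)))"
  proof (rule binom_tr_cong, rule poly_ext)
    fix i x assume "i \<le> r"
    then have ri: "of_nat (r - i) = (of_nat r - of_nat i :: complex)"
      by simp
    have ii: "of_nat i * (of_nat (i - 1) * y) = of_nat i * ((of_nat i - 1) * y)" for y :: complex
      by (cases i) auto
    show "poly (?H i + ?X * smult (of_nat (r - i)) (pderiv (F i))) x = poly ((lead_op * pderiv (pderiv (F i))
        + smult (2 * of_nat i) ([:1, -1:] * pderiv (F i))
        + (smult (of_nat i) (smult (of_nat (r - i)) (F (Suc i))) - smult (of_nat i) (smult (of_nat (i - 1)) (F i))))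
      + ([:of_real (b + 1), - m:] * pderiv (F i)
        + (smult (of_real (b + 1)) (smult (of_nat (r - i)) (F (Suc i))) - smult m (smult (of_nat i) (F i))))
      + [:of_real ((real l - real r) * (real r + 1 + b - k)):] * F (Suc i)
      + [:-1:] * smult z (smult (of_nat (r - i)) (F (Suc i)) - smult (of_nat i) (F i))) x"
      unfolding poly_add poly_diff poly_mult poly_smult ri ii m_def z_def
      by (simp add: algebra_simps)
  qed
  also have "\<dots> = lead_op * pderiv (pderiv (?T F)) + [:of_real (b + 1), - m:] * pderiv (?T F)
      + [:of_real ((real l - real r) * (real r + 1 + b - k)):] * ?T (\<lambda>i. F (Suc i))
      + [:-1:] * ([:1, -1:] * smult (of_real (real r * (real l - real r + k))) (binom_tr (\<lambda>i. F (Suc i)) (r - 1)))"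
    unfolding d2 d1 z binom_tr_add binom_tr_mult ..
  finally show ?thesis
    unfolding m_def neg by (simp only: const diff_conv_add_uminus)
qed

text \<open>The action on coefficients: at the same degree the matrix is upper bidiagonal with the numbers
  \<open>eigval\<close> on the diagonal, and the next higher degree enters through \<open>(n + 1) (C + n)\<close>.\<close>

lemma coeff_D_seq:
  "coeff (D_seq a b k l F i) n =
     of_real ((real n + 1) * (real n + b + 1 + 2 * real i)) * coeff (F i) (Suc n)
     + of_real (real i * (real n + 1)) * coeff (F (i - 1)) (Suc n)
     + of_real (eigval a b k l i n) * coeff (F i) n
     + of_real ((real l - real i) * (real i + b - k + 1)) * coeff (F (Suc i)) n"
proof -
  have lead: "lead_op * q = pCons 0 (q - pCons 0 q)" for q :: "complex poly"
    by (simp add: lead_op_def algebra_simps)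
  consider "n = 0" | "n = 1" | m where "n = Suc (Suc m)"
    by (metis One_nat_def not0_implies_Suc)
  then show ?thesis
    by cases (simp_all add: D_seq_def lead coeff_pderiv eigval_def algebra_simps)
qed

lemma D_seq_cnj: "D_seq a b k l (\<lambda>i. map_poly cnj (F i)) i = map_poly cnj (D_seq a b k l F i)"
  by (rule poly_eqI) (simp add: coeff_D_seq coeff_map_poly)

text \<open>One name for all linear combinations that occur, so that linearity is one rule per argument.\<close>

abbreviation axpy :: "(nat \<Rightarrow> complex poly) \<Rightarrow> complex \<Rightarrow> (nat \<Rightarrow> complex poly) \<Rightarrow> nat \<Rightarrow> complex poly" where
  "axpy F c G \<equiv> (\<lambda>i. F i + smult c (G i))"

lemma binom_tr_axpy: "binom_tr (axpy F c G) r = binom_tr F r + smult c (binom_tr G r)"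
  by (simp add: binom_tr_add binom_tr_smult)

locale jacobi_data =
  fixes a b k :: real and l :: nat
  assumes a: "a > -1" and b: "b > -1" and k: "0 < k" "k < b + 1" and l: "l \<ge> 1"
begin

abbreviation "D \<equiv> D_seq a b k l"

section \<open>The inner product and the symmetry of the operator\<close>

text \<open>The factors \<open>c\<^sub>r\<close> of the diagonalized weight.\<close>

definition wt :: "nat \<Rightarrow> real" where
  "wt r = ((real l + k - real r - 1) gchoose (l - r)) * ((b - k + real r) gchoose r)"

lemma wt_eq:
  assumes "r \<le> l"
  shows "wt r = pochhammer k (l - r) / fact (l - r) * (pochhammer (b - k + 1) r / fact r)"
proof -
  have "real l + k - real r - 1 - real (l - r) + 1 = k" "b - k + real r - real r + 1 = b - k + 1"
    using assms by (simp_all add: of_nat_diff)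
  then show ?thesis
    unfolding wt_def gbinomial_pochhammer' by simp
qed

lemma wt_pos: "r \<le> l \<Longrightarrow> wt r > 0"
  using k by (simp add: wt_eq pochhammer_pos)

text \<open>Detailed balance between the two directions of coupling. It makes the difference operator in \<open>r\<close>
  symmetric for the weights \<open>wt\<close>.\<close>

lemma wt_step:
  assumes "r < l"
  shows "wt (Suc r) * (real (Suc r) * (real l - real (Suc r) + k)) = wt r * ((real l - real r) * (real r + 1 + b - k))"
proof -
  define n where "n = l - Suc r"
  have n: "l - r = Suc n" "l - Suc r = n" "real l = real r + real n + 1"
    using assms by (auto simp: n_def)
  define u v B where "u = real r + 1" and "v = real n + 1" and "B = b - k + 1 + real r"
  have w: "wt r = pochhammer k n * (k + real n) / (v * fact n) * (pochhammer (b - k + 1) r / fact r)"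
    using assms by (simp add: wt_eq n(1) pochhammer_Suc add_ac v_def)
  have w': "wt (Suc r) = pochhammer k n / fact n * (pochhammer (b - k + 1) r * B / (u * fact r))"
    using assms by (simp add: wt_eq n(2) pochhammer_Suc add_ac u_def B_def)
  have e: "real (Suc r) = u" "real l - u + k = k + real n" "real l - real r = v" "real r + 1 + b - k = B"
    by (simp_all add: u_def v_def B_def n(3))
  have "u > 0" "v > 0"
    by (simp_all add: u_def v_def)
  then show ?thesis
    unfolding w w' e by simp
qed

definition J :: "nat \<Rightarrow> complex poly \<Rightarrow> complex" where
  "J r = jacobi_int (a + real (l - r)) b"

lemma exponents: "a + real n > -1" "b > -1"
  using a b by simp_all

lemma J_linear:
  "J r (p + q) = J r p + J r q" "J r (p - q) = J r p - J r q" "J r (smult c p) = c * J r p" "J r (- p) = - J r p"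
  unfolding J_def
  by (rule jacobi_int_add[OF exponents] jacobi_int_diff[OF exponents] jacobi_int_smult jacobi_int_minus)+

text \<open>The exponents of \<open>1 - u\<close> of neighbouring components differ by one, and the coupling downwards in \<open>r\<close>
  carries exactly the factor \<open>1 - u\<close> that compensates this.\<close>

lemma J_raise:
  assumes "r < l"
  shows "J (Suc r) ([:1, -1:] * p) = J r p"
proof -
  have "a + real (l - r) = a + real (l - Suc r) + 1"
    using assms by simp
  then show ?thesis
    unfolding J_def by (simp only: jacobi_int_raise)
qed

text \<open>The pairing is first treated as a bilinear form, where symmetry of the operator is a statement
  about an expression that is visibly symmetric; conjugation comes in afterwards.\<close>

definition bform :: "(nat \<Rightarrow> complex poly) \<Rightarrow> (nat \<Rightarrow> complex poly) \<Rightarrow> complex" where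
  "bform F G = (\<Sum>r\<le>l. of_real (wt r) * J r (binom_tr F r * binom_tr G r))"

lemma bform_commute: "bform F G = bform G F"
  by (simp add: bform_def mult.commute)

lemma bform_cong: "(\<And>i. i \<le> l \<Longrightarrow> F i = F' i) \<Longrightarrow> bform F G = bform F' G"
proof -
  assume "\<And>i. i \<le> l \<Longrightarrow> F i = F' i"
  then have "binom_tr F r = binom_tr F' r" if "r \<le> l" for r
    using that by (intro binom_tr_cong) auto
  then show ?thesis
    by (simp add: bform_def)
qed

lemma bform_axpy: "bform (axpy F c G) Q = bform F Q + c * bform G Q"
  by (simp add: bform_def binom_tr_axpy distrib_right J_linear distrib_left sum.distrib sum_distrib_left mult.left_commute)

text \<open>Integration by parts removes the first two terms of \<open>binom_tr_D_seq\<close>. In the coupling terms,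
  \<open>J_raise\<close> and \<open>wt_step\<close> give the downward term of component \<open>r + 1\<close> the same weight as the upward
  term of component \<open>r\<close>, so that they combine to a difference of the transform of \<open>G\<close>, which is \<open>u\<close> times a polynomial.\<close>

lemma bform_D_Dirichlet:
  "bform (D F) G =
     - (\<Sum>r\<le>l. of_real (wt r) * J r (lead_op * pderiv (binom_tr F r) * pderiv (binom_tr G r)))
     - (\<Sum>r<l. of_real (wt r * ((real l - real r) * (real r + 1 + b - k)))
         * J r ([:0, 1:] * binom_tr (\<lambda>i. F (Suc i)) r * binom_tr (\<lambda>i. G (Suc i)) r))"
proof -
  define x where "x r = (real l - real r) * (real r + 1 + b - k)" for r
  define z where "z r = real r * (real l - real r + k)" for r
  let ?f = "binom_tr F" and ?g = "binom_tr G"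
  let ?E = "binom_tr (\<lambda>i. F (Suc i))" and ?EG = "binom_tr (\<lambda>i. G (Suc i))"
  have main: "J r (binom_tr (D F) r * ?g r) =
      - J r (lead_op * pderiv (?f r) * pderiv (?g r)) + of_real (x r) * J r (?E r * ?g r)
      - of_real (z r) * J r ([:1, -1:] * (?E (r - 1) * ?g r))" if "r \<le> l" for r
  proof -
    have e: "a + real (l - r) + b + 2 = a + b + real l - real r + 2"
      using that by (simp add: of_nat_diff)
    have "binom_tr (D F) r * ?g r =
        (lead_op * pderiv (pderiv (?f r) * ?g r)
          + [:of_real (b + 1), - of_real (a + real (l - r) + b + 2):] * (pderiv (?f r) * ?g r))
        - lead_op * pderiv (?f r) * pderiv (?g r)
        + smult (of_real (x r)) (?E r * ?g r) - smult (of_real (z r)) ([:1, -1:] * (?E (r - 1) * ?g r))"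
      unfolding binom_tr_D_seq e x_def z_def pderiv_mult
      by (rule poly_ext) (simp add: algebra_simps)
    moreover have "J r (lead_op * pderiv (pderiv (?f r) * ?g r)
          + [:of_real (b + 1), - of_real (a + real (l - r) + b + 2):] * (pderiv (?f r) * ?g r)) = 0"
      unfolding J_def by (rule jacobi_int_exact[OF exponents])
    ultimately show ?thesis
      by (simp only: J_linear) simp
  qed
  have "bform (D F) G = - (\<Sum>r\<le>l. of_real (wt r) * J r (lead_op * pderiv (?f r) * pderiv (?g r)))
      + (\<Sum>r\<le>l. of_real (wt r * x r) * J r (?E r * ?g r))
      - (\<Sum>r\<le>l. of_real (wt r * z r) * J r ([:1, -1:] * (?E (r - 1) * ?g r)))"
    unfolding bform_def sum_negf[symmetric] sum.distrib[symmetric] sum_subtractf[symmetric]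
    by (intro sum.cong refl) (simp only: main atMost_iff of_real_mult distrib_left right_diff_distrib mult_minus_right mult.assoc)
  also have "(\<Sum>r\<le>l. of_real (wt r * x r) * J r (?E r * ?g r)) = (\<Sum>r<l. of_real (wt r * x r) * J r (?E r * ?g r))"
    unfolding lessThan_Suc_atMost[symmetric] by (simp add: x_def)
  also have "(\<Sum>r\<le>l. of_real (wt r * z r) * J r ([:1, -1:] * (?E (r - 1) * ?g r)))
      = (\<Sum>r<l. of_real (wt (Suc r) * z (Suc r)) * J (Suc r) ([:1, -1:] * (?E r * ?g (Suc r))))"
    unfolding lessThan_Suc_atMost[symmetric] sum.lessThan_Suc_shift by (simp add: z_def del: mult_pCons_left)
  also have "\<dots> = (\<Sum>r<l. of_real (wt r * x r) * J r (?E r * ?g (Suc r)))"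
    by (intro sum.cong refl) (simp only: J_raise wt_step x_def z_def lessThan_iff)
  also have "\<dots> = (\<Sum>r<l. of_real (wt r * x r) * J r (?E r * ?g r))
      + (\<Sum>r<l. of_real (wt r * x r) * J r ([:0, 1:] * ?E r * ?EG r))"
    unfolding sum.distrib[symmetric]
  proof (intro sum.cong refl)
    fix r
    have "?E r * ?g (Suc r) = ?E r * ?g r + [:0, 1:] * ?E r * ?EG r"
      unfolding binom_tr_Suc by (simp only: distrib_left mult_ac)
    then show "of_real (wt r * x r) * J r (?E r * ?g (Suc r)) = of_real (wt r * x r) * J r (?E r * ?g r)
        + of_real (wt r * x r) * J r ([:0, 1:] * ?E r * ?EG r)"
      by (simp only: J_linear distrib_left)
  qed
  finally show ?thesis
    by (simp only: x_def) simp
qed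

lemma bform_D_symmetric: "bform (D F) G = bform F (D G)"
  unfolding bform_commute[of F "D G"] bform_D_Dirichlet by (simp only: mult_ac)

definition hform :: "(nat \<Rightarrow> complex poly) \<Rightarrow> (nat \<Rightarrow> complex poly) \<Rightarrow> complex" where
  "hform F G = bform F (\<lambda>i. map_poly cnj (G i))"

lemma hform_D_symmetric: "hform (D F) G = hform F (D G)"
  by (simp add: hform_def bform_D_symmetric flip: D_seq_cnj)

lemma hform_cong: "(\<And>i. i \<le> l \<Longrightarrow> F i = F' i) \<Longrightarrow> hform F G = hform F' G"
  unfolding hform_def by (rule bform_cong)

lemma hform_cong_right: "(\<And>i. i \<le> l \<Longrightarrow> G i = G' i) \<Longrightarrow> hform F G = hform F G'"
  unfolding hform_def bform_commute[of F] by (rule bform_cong) simp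

lemma map_poly_cnj_axpy: "map_poly cnj (p + smult c q) = map_poly cnj p + smult (cnj c) (map_poly cnj q)"
  by (rule poly_eqI) (simp add: coeff_map_poly)

lemma hform_axpy: "hform (axpy F c G) Q = hform F Q + c * hform G Q"
  by (simp add: hform_def bform_axpy)

lemma hform_axpy_right: "hform Q (axpy F c G) = hform Q F + cnj c * hform Q G"
  by (simp add: hform_def bform_commute[of Q] bform_axpy map_poly_cnj_axpy)

lemma hform_zero_right: "(\<And>i. i \<le> l \<Longrightarrow> G i = 0) \<Longrightarrow> hform F G = 0"
  using hform_cong_right[of G "\<lambda>i. 0" F] by (simp add: hform_def bform_def binom_tr_def J_def)

lemma hform_cnj: "cnj (hform F G) = hform G F"
proof -
  have "map_poly cnj (map_poly cnj p) = p" for p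
    by (rule poly_ext) simp
  then show ?thesis
    by (simp add: hform_def bform_def J_def binom_tr_cnj mult.commute flip: jacobi_int_cnj add: map_poly_cnj_mult)
qed

lemma hform_definite:
  assumes "hform F F = 0" "i \<le> l"
  shows "F i = 0"
proof -
  have "\<exists>x. \<forall>r. x r \<ge> 0 \<and> J r (binom_tr F r * map_poly cnj (binom_tr F r)) = of_real (x r) \<and> (x r = 0 \<longrightarrow> binom_tr F r = 0)"
    unfolding J_def using jacobi_int_square[OF exponents] by (intro choice) blast
  then obtain x where x: "\<And>r. x r \<ge> 0" "\<And>r. J r (binom_tr F r * map_poly cnj (binom_tr F r)) = of_real (x r)"
      "\<And>r. x r = 0 \<Longrightarrow> binom_tr F r = 0"
    by blast
  have "hform F F = of_real (\<Sum>r\<le>l. wt r * x r)"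
    by (simp add: hform_def bform_def binom_tr_cnj x(2))
  with assms(1) have "(\<Sum>r\<le>l. wt r * x r) = 0"
    by (simp only: of_real_eq_0_iff)
  moreover have "\<forall>r\<in>{..l}. 0 \<le> wt r * x r"
    using x(1) by (auto intro!: mult_nonneg_nonneg less_imp_le[OF wt_pos])
  ultimately have "wt r * x r = 0" if "r \<le> l" for r
    using that by (subst (asm) sum_nonneg_eq_0_iff) auto
  then have "x r = 0" if "r \<le> l" for r
    using that wt_pos[of r] by force
  then show ?thesis
    using assms(2) x(3) binom_tr_eq_0_imp by blast
qed

section \<open>Orthogonal projection\<close>

definition has_projection :: "(nat \<Rightarrow> complex poly) set \<Rightarrow> bool" where
  "has_projection S \<longleftrightarrow> (\<forall>F. \<exists>H\<in>S. \<forall>Q\<in>S. hform (axpy F (-1) H) Q = 0)"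

text \<open>One Gram-Schmidt step. If \<open>e\<close> already lies in \<open>S\<close> up to a null vector, then the quotient \<open>t\<close> is \<open>0 / 0 = 0\<close>
  and the projection does not change.\<close>

lemma has_projection_extend:
  assumes proj: "has_projection S"
    and closed: "\<And>F G c. F \<in> S \<Longrightarrow> G \<in> S \<Longrightarrow> axpy F c G \<in> S"
    and sub: "\<And>F c. F \<in> S \<Longrightarrow> axpy F c e \<in> S'"
    and sup: "\<And>Q. Q \<in> S' \<Longrightarrow> \<exists>F\<in>S. \<exists>c. Q = axpy F c e"
  shows "has_projection S'"
  unfolding has_projection_def
proof
  fix F
  obtain H where H: "H \<in> S" "\<And>Q. Q \<in> S \<Longrightarrow> hform (axpy F (-1) H) Q = 0"
    using proj unfolding has_projection_def by blast
  obtain H' where H': "H' \<in> S" "\<And>Q. Q \<in> S \<Longrightarrow> hform (axpy e (-1) H') Q = 0"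
    using proj unfolding has_projection_def by blast
  let ?F' = "axpy F (-1) H" and ?e' = "axpy e (-1) H'"
  define t where "t = hform ?F' ?e' / hform ?e' ?e'"
  (* H + t e', regrouped as an element of S plus a multiple of e *)
  let ?R = "axpy (axpy H (- t) H') t e"
  have R: "axpy F (-1) ?R = axpy ?F' (- t) ?e'"
    by (simp add: fun_eq_iff smult_add_right smult_diff_right)
  have orthS: "hform (axpy F (-1) ?R) Q = 0" if "Q \<in> S" for Q
    unfolding R hform_axpy[of ?F'] using H(2)[OF that] H'(2)[OF that] by simp
  have "hform ?F' ?e' = 0" if "hform ?e' ?e' = 0"
    by (rule hform_zero_right) (rule hform_definite[OF that])
  then have "hform (axpy F (-1) ?R) ?e' = 0"
    unfolding R hform_axpy[of ?F'] by (auto simp: t_def)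
  then have "hform (axpy F (-1) ?R) (axpy ?e' 1 H') = 0"
    using orthS[OF H'(1)] by (simp only: hform_axpy_right[of _ ?e' 1 H']) simp
  moreover have "axpy ?e' 1 H' = e"
    by simp
  ultimately have orthe: "hform (axpy F (-1) ?R) e = 0"
    by (simp only:)
  have "?R \<in> S'"
    by (rule sub[OF closed[OF H(1) H'(1)]])
  moreover have "\<forall>Q\<in>S'. hform (axpy F (-1) ?R) Q = 0"
  proof
    fix Q assume "Q \<in> S'"
    from sup[OF this] obtain F0 c where Q: "F0 \<in> S" "Q = axpy F0 c e"
      by blast
    show "hform (axpy F (-1) ?R) Q = 0"
      unfolding Q(2) hform_axpy_right orthe orthS[OF Q(1)] by simp
  qed
  ultimately show "\<exists>H\<in>S'. \<forall>Q\<in>S'. hform (axpy F (-1) H) Q = 0"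
    by (rule bexI[where x = ?R and P = "\<lambda>H. \<forall>Q\<in>S'. hform (axpy F (-1) H) Q = 0", rotated])
qed

text \<open>The polynomials of degree less than \<open>n\<close>, where degree \<open>n\<close> is allowed in the first \<open>q\<close> components.
  So \<open>stair n 0\<close> are those of degree less than \<open>n\<close>, and each step of \<open>q\<close> adds one dimension.\<close>

definition stair :: "nat \<Rightarrow> nat \<Rightarrow> (nat \<Rightarrow> complex poly) set" where
  "stair n q = {F. \<forall>i\<le>l. \<forall>m. (if i < q then n < m else n \<le> m) \<longrightarrow> coeff (F i) m = 0}"

lemma stair_axpy: "F \<in> stair n q \<Longrightarrow> G \<in> stair n q \<Longrightarrow> axpy F c G \<in> stair n q"
  by (auto simp: stair_def)

lemma has_projection_stair_Suc:
  assumes "has_projection (stair n q)" "q \<le> l"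
  shows "has_projection (stair n (Suc q))"
proof (rule has_projection_extend[OF assms(1)])
  let ?e = "\<lambda>i. if i = q then monom 1 n else 0"
  show "axpy F c ?e \<in> stair n (Suc q)" if "F \<in> stair n q" for F c
    using that by (auto simp: stair_def less_Suc_eq split: if_splits)
  show "\<exists>F\<in>stair n q. \<exists>c. Q = axpy F c ?e" if "Q \<in> stair n (Suc q)" for Q
  proof (intro bexI exI)
    let ?c = "coeff (Q q) n"
    show "Q = axpy (axpy Q (- ?c) ?e) ?c ?e"
      by auto
    show "axpy Q (- ?c) ?e \<in> stair n q"
      using that assms(2) by (auto simp: stair_def less_Suc_eq split: if_splits)
  qed
qed (rule stair_axpy)

lemma stair_full: "stair n (Suc l) = stair (Suc n) 0"
  by (auto simp: stair_def Suc_le_eq)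

lemma has_projection_stair: "has_projection (stair n 0)"
proof (induction n)
  case 0
  have "hform G Q = 0" if "Q \<in> stair 0 0" for G Q
    by (rule hform_zero_right) (use that in \<open>auto simp: stair_def poly_eq_iff\<close>)
  moreover have "(\<lambda>i. 0) \<in> stair 0 0"
    by (simp add: stair_def)
  ultimately show ?case
    unfolding has_projection_def by blast
next
  case (Suc n)
  have "has_projection (stair n q)" if "q \<le> Suc l" for q
    using that by (induction q) (use Suc has_projection_stair_Suc in auto)
  from this[of "Suc l"] show ?case
    by (simp add: stair_full)
qed

section \<open>Eigenfunctions and their leading coefficients\<close>

abbreviation "ev \<equiv> eigval a b k l"

lemma ev_diff: "ev i n - ev j n = (real j - real i) * (real n + real i + real j + a + b - k + 1)"
  by (simp add: eigval_def algebra_simps)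

text \<open>The second factor of the difference is positive for \<open>i \<noteq> j\<close>, since then \<open>i + j \<ge> 1\<close>, while \<open>a > -1\<close>
  and \<open>b - k + 1 > 0\<close>. Hence the pairs with a common eigenvalue have distinct degrees.\<close>

lemma ev_inj:
  assumes "ev i n = ev j n"
  shows "i = j"
proof (rule ccontr)
  assume "i \<noteq> j"
  then have "real i + real j \<ge> 1"
    by linarith
  then have "real n + real i + real j + a + b - k + 1 > 0"
    using a k by linarith
  then show False
    using ev_diff[of i n j] assms \<open>i \<noteq> j\<close> by simp
qed

lemma ev_inj_degree:
  assumes "ev j n = ev j m"
  shows "n = m"
proof (rule ccontr)
  assume "n \<noteq> m"
  then have "real n + real m \<ge> 1"
    by linarith
  then have "real n + real m + a + b + real l + real j + 1 > 0"
    using a b l by linarith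
  moreover have "ev j n - ev j m = (real m - real n) * (real n + real m + a + b + real l + real j + 1)"
    by (simp add: eigval_def algebra_simps)
  ultimately show False
    using assms \<open>n \<noteq> m\<close> by simp
qed

definition top_entry :: "nat \<Rightarrow> nat \<Rightarrow> nat \<Rightarrow> real" where
  "top_entry j w i = (if i \<le> j then
        (-1) ^ (i + j) * real ((l - i) choose (l - j))
        * (pochhammer (b - k + 1 + real i) (j - i)
           / pochhammer (a + b + real j + real i + real w - k + 1) (j - i))
      else 0)"

lemma top_entry_diag [simp]: "top_entry j w j = 1"
  by (simp add: top_entry_def flip: power_add mult_2)

text \<open>The kernel equation of an upper bidiagonal matrix: the entries are determined, going down from \<open>i = j\<close>,
  by the quotients of two consecutive ones.\<close>

lemma top_entry_rec:
  assumes "j \<le> l"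
  shows "(ev i w - ev j w) * top_entry j w i + (real l - real i) * (real i + b - k + 1) * top_entry j w (Suc i) = 0"
proof (cases "i < j")
  case False
  then show ?thesis
    by (cases "i = j") (auto simp: top_entry_def)
next
  case True
  define n where "n = j - Suc i"
  have n: "j - i = Suc n" "j - Suc i = n" "real j - real i = real n + 1"
    using True by (auto simp: n_def)
  define s where "s = a + b + real j + real i + real w - k + 1"
  define B where "B = b - k + 1 + real i"
  have "real j \<ge> 1"
    using True by linarith
  then have s: "s > 0"
    using a k by (simp add: s_def)
  have c: "(real n + 1) * real ((l - i) choose (l - j)) = (real l - real i) * real ((l - Suc i) choose (l - j))"
  proof -
    have "Suc n * ((l - i) choose (l - j)) = (l - i) * ((l - Suc i) choose (l - j))"
      using binomial_absorb_comp[of "l - i" "l - j"] True assms by (simp add: n(1)[symmetric])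
    then have "real (Suc n * ((l - i) choose (l - j))) = real ((l - i) * ((l - Suc i) choose (l - j)))"
      by (simp only:)
    then show ?thesis
      using True assms by (simp add: of_nat_diff distrib_right)
  qed
  have t: "top_entry j w i = (-1) ^ (i + j) * real ((l - i) choose (l - j)) * (B * pochhammer (B + 1) n / (s * pochhammer (s + 1) n))"
    using True unfolding top_entry_def n(1) pochhammer_rec s_def B_def by simp
  have t': "top_entry j w (Suc i) = - ((-1) ^ (i + j)) * real ((l - Suc i) choose (l - j)) * (pochhammer (B + 1) n / pochhammer (s + 1) n)"
    using True unfolding top_entry_def n(2) s_def B_def by (simp add: add_ac)
  have e: "ev i w - ev j w = (real n + 1) * s"
    unfolding ev_diff n(3) s_def by (simp add: algebra_simps)
  have "(ev i w - ev j w) * top_entry j w i = (-1) ^ (i + j) * ((real n + 1) * real ((l - i) choose (l - j))) * (B * (pochhammer (B + 1) n / pochhammer (s + 1) n))"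
    unfolding e t using s by simp
  also have "\<dots> = - ((real l - real i) * B * top_entry j w (Suc i))"
    unfolding c t' by simp
  finally show ?thesis
    by (simp add: B_def algebra_simps)
qed

definition eigenfunction :: "complex \<Rightarrow> (nat \<Rightarrow> complex poly) \<Rightarrow> bool" where
  "eigenfunction z F \<longleftrightarrow> (\<forall>i\<le>l. D F i = smult z (F i))"

lemma D_stair: "F \<in> stair n 0 \<Longrightarrow> D F \<in> stair n 0"
  unfolding stair_def
proof (intro CollectI allI impI)
  fix i m assume F: "F \<in> {F. \<forall>i\<le>l. \<forall>m. (if i < 0 then n < m else n \<le> m) \<longrightarrow> coeff (F i) m = 0}"
    and i: "i \<le> l" and m: "if i < 0 then n < m else n \<le> m"
  then have "(real l - real i) * (real i + b - k + 1) = 0 \<or> coeff (F (Suc i)) m = 0"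
    by (cases "i = l") auto
  with F i m show "coeff (D F i) m = 0"
    by (auto simp: coeff_D_seq simp del: of_real_mult of_real_diff of_real_add)
qed

text \<open>The orthogonal projection of \<open>u\<^sup>w\<close> times the leading eigenvector to the lower degrees is subtracted.
  The defect \<open>R\<close> of the eigenvalue equation has degree less than \<open>w\<close>, because the leading coefficient
  satisfies \<open>top_entry_rec\<close>. By symmetry \<open>(R, R) = (F, D R) - \<lambda> (F, R)\<close>, and both terms vanish
  because \<open>R\<close> and \<open>D R\<close> have degree less than \<open>w\<close>.\<close>

lemma eigenfunction_exists:
  assumes "j \<le> l"
  shows "\<exists>F. eigenfunction (of_real (ev j w)) F \<and> F \<in> stair (Suc w) 0
     \<and> (\<forall>i\<le>l. coeff (F i) w = of_real (top_entry j w i)) \<and> (\<forall>Q\<in>stair w 0. hform F Q = 0)"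
proof -
  let ?z = "complex_of_real (ev j w)"
  let ?X = "\<lambda>i. monom (complex_of_real (top_entry j w i)) w"
  from has_projection_stair[of w, unfolded has_projection_def, rule_format, of ?X]
  obtain H where H: "H \<in> stair w 0" and orth: "\<And>Q. Q \<in> stair w 0 \<Longrightarrow> hform (axpy ?X (-1) H) Q = 0"
    by blast
  define F where "F = axpy ?X (-1) H"
  have top: "coeff (F i) w = of_real (top_entry j w i)" if "i \<le> l" for i
    using H that by (simp add: F_def stair_def)
  have deg: "F \<in> stair (Suc w) 0"
    using H by (simp add: F_def stair_def Suc_le_eq)
  let ?R = "axpy (D F) (- ?z) F"
  have R: "?R \<in> stair w 0"
    unfolding stair_def
  proof (intro CollectI allI impI)
    fix i m assume i: "i \<le> l" and m: "if i < 0 then w < m else w \<le> m"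
    show "coeff (?R i) m = 0"
    proof (cases "m = w")
      case True
      have "coeff (F i) (Suc w) = 0" "coeff (F (i - 1)) (Suc w) = 0"
        using deg i by (auto simp: stair_def)
      then have "coeff (?R i) m = of_real (ev i w) * of_real (top_entry j w i)
          + of_real ((real l - real i) * (real i + b - k + 1)) * coeff (F (Suc i)) w - ?z * of_real (top_entry j w i)"
        unfolding True coeff_add coeff_smult coeff_D_seq top[OF i] by simp
      also have "of_real ((real l - real i) * (real i + b - k + 1)) * coeff (F (Suc i)) w
          = complex_of_real ((real l - real i) * (real i + b - k + 1) * top_entry j w (Suc i))"
        using i top[of "Suc i"] by (cases "i = l") auto
      also have "of_real (ev i w) * of_real (top_entry j w i)
          + complex_of_real ((real l - real i) * (real i + b - k + 1) * top_entry j w (Suc i)) - ?z * of_real (top_entry j w i)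
        = of_real ((ev i w - ev j w) * top_entry j w i + (real l - real i) * (real i + b - k + 1) * top_entry j w (Suc i))"
        by (simp add: algebra_simps)
      finally show ?thesis
        unfolding top_entry_rec[OF assms] by simp
    next
      case False
      then show ?thesis
        using deg D_stair[OF deg] i m by (simp add: stair_def)
    qed
  qed
  have "hform ?R ?R = 0"
  proof -
    have "hform ?R ?R = hform F (D ?R) - ?z * hform F ?R"
      unfolding hform_axpy hform_D_symmetric by simp
    then show ?thesis
      using orth[OF D_stair[OF R]] orth[OF R] by (simp add: F_def)
  qed
  then have "?R i = 0" if "i \<le> l" for i
    by (rule hform_definite) (rule that)
  then have "eigenfunction ?z F"
    unfolding eigenfunction_def by simp
  with deg top orth show ?thesis
    unfolding F_def by blast
qed

lemma eigenfunctions_orthogonal: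
  assumes "eigenfunction (of_real x) F" "eigenfunction (of_real y) G" "x \<noteq> y"
  shows "hform F G = 0"
proof -
  have zero: "hform (axpy (\<lambda>i. 0) c F) Q = c * hform F Q" "hform Q (axpy (\<lambda>i. 0) c F) = cnj c * hform Q F" for c F Q
    unfolding hform_axpy hform_axpy_right by (simp_all add: hform_zero_right flip: hform_cnj[of _ "\<lambda>i. 0"])
  have "of_real x * hform F G = hform (D F) G"
    unfolding zero(1)[symmetric] using assms(1) by (intro hform_cong) (simp add: eigenfunction_def)
  also have "\<dots> = hform F (D G)"
    by (rule hform_D_symmetric)
  also have "\<dots> = hform F (axpy (\<lambda>i. 0) (of_real y) G)"
    using assms(2) by (intro hform_cong_right) (simp add: eigenfunction_def)
  also have "\<dots> = of_real y * hform F G"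
    unfolding zero(2) by simp
  finally show ?thesis
    using assms(3) by simp
qed

lemma eigenfunction_top_rec:
  assumes "eigenfunction z F" "F \<in> stair (Suc n) 0" "i \<le> l"
  shows "(of_real (ev i n) - z) * coeff (F i) n + of_real ((real l - real i) * (real i + b - k + 1)) * coeff (F (Suc i)) n = 0"
proof -
  have "coeff (D F i) n = z * coeff (F i) n"
    using assms(1,3) by (simp add: eigenfunction_def)
  moreover have "coeff (F i) (Suc n) = 0" "coeff (F (i - 1)) (Suc n) = 0"
    using assms(2,3) by (auto simp: stair_def)
  ultimately show ?thesis
    by (simp add: coeff_D_seq algebra_simps)
qed

text \<open>Downward induction on \<open>i\<close>: once \<open>y (Suc i)\<close> is zero, \<open>d i * y i = 0\<close> remains, and at \<open>i = l\<close> the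
  superdiagonal term is absent.\<close>

lemma bidiagonal_zero:
  fixes y :: "nat \<Rightarrow> complex"
  assumes rec: "\<And>i. i \<le> l \<Longrightarrow> d i * y i + of_real ((real l - real i) * e i) * y (Suc i) = 0"
    and "\<And>i. i \<le> l \<Longrightarrow> d i = 0 \<Longrightarrow> y i = 0" and "i \<le> l"
  shows "y i = 0"
  using assms(3)
proof (induction "l - i" arbitrary: i)
  case 0
  then show ?case
    using rec[of i] assms(2)[of i] by auto
next
  case (Suc m)
  then have "y (Suc i) = 0"
    by (intro Suc.hyps(1)) auto
  then show ?case
    using rec[of i] assms(2)[of i] Suc.prems by auto
qed

text \<open>The leading coefficient is an eigenvector of the triangular matrix for that degree.\<close>

lemma eigenvalue_from_degree:
  assumes "eigenfunction z F" "F \<in> stair (Suc n) 0" "F \<notin> stair n 0"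
  shows "\<exists>j\<le>l. z = of_real (ev j n)"
proof (rule ccontr)
  assume neg: "\<not> (\<exists>j\<le>l. z = of_real (ev j n))"
  have "coeff (F i) n = 0" if "i \<le> l" for i
    using eigenfunction_top_rec[OF assms(1,2)]
    by (rule bidiagonal_zero[where d = "\<lambda>i. of_real (ev i n) - z" and y = "\<lambda>i. coeff (F i) n"]) (use neg that in auto)
  then have "F \<in> stair n 0"
    using assms(2) by (auto simp: stair_def) (metis le_antisym not_less_eq_eq)
  with assms(3) show False
    by contradiction
qed

text \<open>The eigenspace of the triangular matrix is one-dimensional since its diagonal entries are distinct:
  the difference \<open>y\<close> of the two sides solves the same recursion and vanishes at \<open>j\<close>.\<close>

lemma top_coeff_proportional:
  assumes "eigenfunction (of_real (ev j n)) F" "F \<in> stair (Suc n) 0" "j \<le> l" "i \<le> l"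
  shows "coeff (F i) n = coeff (F j) n * of_real (top_entry j n i)"
proof -
  define y where "y i = coeff (F i) n - coeff (F j) n * of_real (top_entry j n i)" for i
  have "(of_real (ev i n - ev j n)) * y i + of_real ((real l - real i) * (real i + b - k + 1)) * y (Suc i) = 0" if "i \<le> l" for i
  proof -
    have "complex_of_real ((ev i n - ev j n) * top_entry j n i + (real l - real i) * (real i + b - k + 1) * top_entry j n (Suc i)) = 0"
      unfolding top_entry_rec[OF assms(3)] by simp
    then have "coeff (F j) n * (of_real (ev i n - ev j n) * of_real (top_entry j n i) + of_real ((real l - real i) * (real i + b - k + 1)) * of_real (top_entry j n (Suc i))) = 0"
      by simp
    moreover have "of_real (ev i n - ev j n) * coeff (F i) n + of_real ((real l - real i) * (real i + b - k + 1)) * coeff (F (Suc i)) n = 0"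
      using eigenfunction_top_rec[OF assms(1,2) that] by simp
    moreover have "E * (v - C * t) + G * (v' - C * t') = 0" if "C * (E * t + G * t') = 0" "E * v + G * v' = 0"
      for E G v v' C t t' :: complex
    proof -
      have "E * (v - C * t) + G * (v' - C * t') = (E * v + G * v') - C * (E * t + G * t')"
        by (simp add: algebra_simps)
      then show ?thesis
        using that by simp
    qed
    ultimately show ?thesis
      unfolding y_def by blast
  qed
  then have "y i = 0"
    by (rule bidiagonal_zero[where d = "\<lambda>i. of_real (ev i n - ev j n)"]) (use assms(4) in \<open>auto simp: y_def dest: ev_inj\<close>)
  then show ?thesis
    by (simp add: y_def)
qed

end

section \<open>Bidiagonal matrices and the recursion for the coefficients\<close>

lemma mult_lower_bidiagonal:
  fixes A :: "'a :: comm_ring_1 mat"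
  assumes "A \<in> carrier_mat n n" "v \<in> carrier_vec n" "i < n"
    and "\<And>i j. i < n \<Longrightarrow> j < n \<Longrightarrow> A $$ (i, j) = (if i = j then p i else if i = j + 1 then q i else 0)"
  shows "(A *\<^sub>v v) $ i = p i * v $ i + (if i = 0 then 0 else q i * v $ (i - 1))"
proof -
  have "(A *\<^sub>v v) $ i = (\<Sum>j\<in>{0..<n}. A $$ (i, j) * v $ j)"
    using assms(1-3) by (simp add: scalar_prod_def)
  also have "\<dots> = (\<Sum>j\<in>{0..<n}. (if j = i then p i * v $ i else 0)
      + (if j = i - 1 then (if i = 0 then 0 else q i * v $ (i - 1)) else 0))"
    by (intro sum.cong refl) (use assms(3,4) in auto)
  also have "\<dots> = p i * v $ i + (if i = 0 then 0 else q i * v $ (i - 1))"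
    unfolding sum.distrib using assms(3) by (simp add: sum.delta)
  finally show ?thesis .
qed

lemma mult_upper_bidiagonal:
  fixes A :: "'a :: comm_ring_1 mat"
  assumes "A \<in> carrier_mat n n" "v \<in> carrier_vec n" "i < n"
    and "\<And>i j. i < n \<Longrightarrow> j < n \<Longrightarrow> A $$ (i, j) = (if i = j then p i else if j = i + 1 then q i else 0)"
  shows "(A *\<^sub>v v) $ i = p i * v $ i + (if Suc i < n then q i * v $ (Suc i) else 0)"
proof -
  have "(A *\<^sub>v v) $ i = (\<Sum>j\<in>{0..<n}. A $$ (i, j) * v $ j)"
    using assms(1-3) by (simp add: scalar_prod_def)
  also have "\<dots> = (\<Sum>j\<in>{0..<n}. (if j = i then p i * v $ i else 0)
      + (if j = Suc i then q i * v $ Suc i else 0))"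
    by (intro sum.cong refl) (use assms(3,4) in auto)
  also have "\<dots> = p i * v $ i + (if Suc i < n then q i * v $ (Suc i) else 0)"
    unfolding sum.distrib using assms(3) by (simp add: sum.delta)
  finally show ?thesis .
qed

lemma det_lower_triangular_nz:
  assumes "A \<in> carrier_mat n n" "\<And>i j. i < j \<Longrightarrow> j < n \<Longrightarrow> A $$ (i, j) = 0" "\<And>i. i < n \<Longrightarrow> A $$ (i, i) \<noteq> (0 :: 'a :: field)"
  shows "Determinant.det A \<noteq> 0"
proof -
  have "Determinant.det A = prod_list (diag_mat A)"
    using assms(2,1) by (rule det_lower_triangular)
  then show ?thesis
    using assms(1,3) by (simp add: prod_list_diag_prod)
qed

lemma det_upper_triangular_nz:
  assumes "A \<in> carrier_mat n n" "upper_triangular A" "\<And>i. i < n \<Longrightarrow> A $$ (i, i) \<noteq> (0 :: 'a :: field)"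
  shows "Determinant.det A \<noteq> 0"
proof -
  have "Determinant.det A = prod_list (diag_mat A)"
    using assms(2,1) by (rule det_upper_triangular)
  then show ?thesis
    using assms(1,3) by (simp add: prod_list_diag_prod)
qed

lemma mat_inverse_of_det_nz:
  assumes A: "A \<in> carrier_mat n n" and "Determinant.det A \<noteq> (0 :: 'a :: field)"
  shows "the (mat_inverse A) \<in> carrier_mat n n" "A * the (mat_inverse A) = 1\<^sub>m n" "the (mat_inverse A) * A = 1\<^sub>m n"
proof -
  have "mat_inverse A \<noteq> None"
    using mat_inverse(1)[OF A, of "()"] det_non_zero_imp_unit[OF assms, of "()"] by blast
  then obtain B where "mat_inverse A = Some B"
    by blast
  with mat_inverse(2)[OF A this]
  show "the (mat_inverse A) \<in> carrier_mat n n" "A * the (mat_inverse A) = 1\<^sub>m n" "the (mat_inverse A) * A = 1\<^sub>m n"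
    by auto
qed

lemma mult_mat_vec_inj_of_det_nz:
  assumes A: "A \<in> carrier_mat n n" and "Determinant.det A \<noteq> (0 :: 'a :: field)"
    and v: "v \<in> carrier_vec n" "v' \<in> carrier_vec n" and eq: "A *\<^sub>v v = A *\<^sub>v v'"
  shows "v = v'"
proof -
  note B = mat_inverse_of_det_nz[OF assms(1,2)]
  have "the (mat_inverse A) *\<^sub>v (A *\<^sub>v v) = the (mat_inverse A) *\<^sub>v (A *\<^sub>v v')"
    unfolding eq ..
  then show ?thesis
    unfolding assoc_mult_mat_vec[OF B(1) A v(1), symmetric] assoc_mult_mat_vec[OF B(1) A v(2), symmetric] B(3)
    using v by simp
qed

definition coeff_vec :: "complex poly Matrix.vec \<Rightarrow> nat \<Rightarrow> complex Matrix.vec" where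
  "coeff_vec P n = map_vec (\<lambda>p. coeff p n) P"

context jacobi_data
begin

text \<open>The matrices in the recursion for \<open>[C; U; V + z]\<^sub>n\<close>: \<open>lower\<close> is lower bidiagonal and always
  invertible, and \<open>upper\<close> is \<open>z\<close> minus the triangular matrix by which the operator acts on the coefficients of \<open>u\<^sup>n\<close>.\<close>

abbreviation lower :: "nat \<Rightarrow> complex mat" where "lower n \<equiv> Cmat b l + of_nat n \<cdot>\<^sub>m 1\<^sub>m (l + 1)"
abbreviation upper :: "complex \<Rightarrow> nat \<Rightarrow> complex mat" where "upper z n \<equiv> of_nat n \<cdot>\<^sub>m (Umat a b l + (of_nat n - 1) \<cdot>\<^sub>m 1\<^sub>m (l + 1)) + Vmat a b k l + z \<cdot>\<^sub>m 1\<^sub>m (l + 1)"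
abbreviation "cuv \<equiv> CUV a b k l"

lemma lower_carrier: "lower n \<in> carrier_mat (l + 1) (l + 1)"
  by (simp add: Cmat_def)

lemma upper_carrier: "upper z n \<in> carrier_mat (l + 1) (l + 1)"
  by (simp add: Vmat_def)

lemma lower_index: "i < l + 1 \<Longrightarrow> j < l + 1 \<Longrightarrow> lower n $$ (i, j) =
    (if i = j then of_real (real n + b + 1 + 2 * real i) else if i = j + 1 then of_real (real i) else 0)"
  by (auto simp: Cmat_def)

lemma upper_index: "i < l + 1 \<Longrightarrow> j < l + 1 \<Longrightarrow> upper z n $$ (i, j) =
    (if i = j then z - of_real (ev i n) else if j = i + 1 then - of_real ((real l - real i) * (real i + b - k + 1)) else 0)"
  by (auto simp: Umat_def Vmat_def mat_diag_def eigval_def algebra_simps)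

lemma lower_det: "Determinant.det (lower n) \<noteq> 0"
proof (rule det_lower_triangular_nz[OF lower_carrier])
  fix i assume "i < l + 1"
  moreover have "real n + b + 1 + 2 * real i > 0"
    using b by linarith
  then have "complex_of_real (real n + b + 1 + 2 * real i) \<noteq> 0"
    by (metis of_real_eq_0_iff less_irrefl)
  ultimately show "lower n $$ (i, i) \<noteq> 0"
    using lower_index[of i i n] by (simp add: algebra_simps)
next
  fix i j assume "i < j" "j < l + 1"
  then show "lower n $$ (i, j) = 0"
    using lower_index[of i j n] by simp
qed

lemma upper_det:
  assumes "\<And>i. i \<le> l \<Longrightarrow> z \<noteq> of_real (ev i n)"
  shows "Determinant.det (upper z n) \<noteq> 0"
proof (rule det_upper_triangular_nz[OF upper_carrier])
  show "upper_triangular (upper z n)"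
  proof (rule upper_triangularI)
    fix i j assume "j < i" "i < dim_row (upper z n)"
    moreover have "dim_row (upper z n) = l + 1"
      using upper_carrier by blast
    ultimately show "upper z n $$ (i, j) = 0"
      using upper_index[where i = i and j = j and n = n and z = z] by simp
  qed
  fix i assume "i < l + 1"
  then show "upper z n $$ (i, i) \<noteq> 0"
    using upper_index[where i = i and j = i and n = n and z = z] assms[of i] by simp
qed

lemma cuv_carrier: "cuv z n \<in> carrier_mat (l + 1) (l + 1)"
proof (induction n)
  case (Suc n)
  then show ?case
    using mat_inverse_of_det_nz(1)[OF lower_carrier lower_det, of n] upper_carrier[where z = z and n = n]
    by (simp only: CUV.simps) (intro mult_carrier_mat)
qed simp

lemma cuv_Suc_vec:
  assumes "v \<in> carrier_vec (l + 1)"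
  shows "cuv z (Suc n) *\<^sub>v v = the (mat_inverse (lower n)) *\<^sub>v (upper z n *\<^sub>v (cuv z n *\<^sub>v v))"
proof -
  note B = mat_inverse_of_det_nz(1)[OF lower_carrier lower_det, of n]
  show ?thesis
    unfolding CUV.simps
    by (subst assoc_mult_mat_vec[OF mult_carrier_mat[OF B upper_carrier] cuv_carrier assms],
        subst assoc_mult_mat_vec[OF B upper_carrier mult_mat_vec_carrier[OF cuv_carrier assms]]) (rule refl)
qed

lemma lower_cuv_Suc:
  assumes "v \<in> carrier_vec (l + 1)"
  shows "lower n *\<^sub>v (cuv z (Suc n) *\<^sub>v v) = upper z n *\<^sub>v (cuv z n *\<^sub>v v)"
proof -
  note B = mat_inverse_of_det_nz[OF lower_carrier lower_det, of n]
  have c: "upper z n *\<^sub>v (cuv z n *\<^sub>v v) \<in> carrier_vec (l + 1)"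
    by (intro mult_mat_vec_carrier[OF upper_carrier] mult_mat_vec_carrier[OF cuv_carrier] assms)
  show ?thesis
    unfolding cuv_Suc_vec[OF assms] assoc_mult_mat_vec[OF lower_carrier B(1) c, symmetric] B(2)
    using c by simp
qed

text \<open>Each factor \<open>upper z m\<close> with \<open>m < n\<close> is invertible when \<open>z\<close> is not an eigenvalue of degree \<open>m\<close>.\<close>

lemma cuv_det:
  assumes "\<And>m i. m < n \<Longrightarrow> i \<le> l \<Longrightarrow> z \<noteq> of_real (ev i m)"
  shows "Determinant.det (cuv z n) \<noteq> 0"
  using assms
proof (induction n)
  case (Suc n)
  note B = mat_inverse_of_det_nz[OF lower_carrier lower_det, of n]
  have "Determinant.det (the (mat_inverse (lower n))) * Determinant.det (lower n) = 1"
    using det_mult[OF B(1) lower_carrier[of n]] unfolding B(3) by simp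
  then have "Determinant.det (the (mat_inverse (lower n))) \<noteq> 0"
    by force
  then show ?case
    using Suc upper_det[where z = z and n = n] unfolding CUV.simps
    by (subst det_mult[OF mult_carrier_mat[OF B(1) upper_carrier] cuv_carrier],
        subst det_mult[OF B(1) upper_carrier]) auto
qed simp

lemma coeff_vec_carrier: "P \<in> carrier_vec (l + 1) \<Longrightarrow> coeff_vec P n \<in> carrier_vec (l + 1)"
  by (simp add: coeff_vec_def)

text \<open>Comparison of coefficients of \<open>u\<^sup>n\<close>.\<close>

lemma eigenfunction_iff_rec:
  assumes P: "P \<in> carrier_vec (l + 1)"
  shows "eigenfunction z (\<lambda>i. P $ i) \<longleftrightarrow>
    (\<forall>n. lower n *\<^sub>v (of_nat (Suc n) \<cdot>\<^sub>v coeff_vec P (Suc n)) = upper z n *\<^sub>v coeff_vec P n)"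
proof -
  have "coeff (D (\<lambda>i. P $ i) i) n = coeff (smult z (P $ i)) n \<longleftrightarrow>
      (lower n *\<^sub>v (of_nat (Suc n) \<cdot>\<^sub>v coeff_vec P (Suc n))) $ i = (upper z n *\<^sub>v coeff_vec P n) $ i"
    if i: "i \<le> l" for i n
  proof -
    have i': "i < l + 1"
      using i by simp
    have c: "coeff_vec P m $ j = coeff (P $ j) m" if "j \<le> l" for m j
      using P that by (auto simp: coeff_vec_def)
    have L: "(lower n *\<^sub>v (of_nat (Suc n) \<cdot>\<^sub>v coeff_vec P (Suc n))) $ i
        = of_real ((real n + 1) * (real n + b + 1 + 2 * real i)) * coeff (P $ i) (Suc n)
          + of_real (real i * (real n + 1)) * coeff (P $ (i - 1)) (Suc n)"
      using P i c[of i] c[of "i - 1"] coeff_vec_carrier[OF P, of "Suc n"]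
      by (subst mult_lower_bidiagonal[OF lower_carrier _ i' lower_index])
         (auto simp: algebra_simps)
    have R: "(upper z n *\<^sub>v coeff_vec P n) $ i = z * coeff (P $ i) n
       - of_real (eigval a b k l i n) * coeff (P $ i) n
       - of_real ((real l - real i) * (real i + b - k + 1)) * coeff (P $ (Suc i)) n"
      using P i c[of i] c[of "Suc i"]
      by (subst mult_upper_bidiagonal[OF upper_carrier coeff_vec_carrier[OF P] i' upper_index])
         (auto simp: algebra_simps)
    show ?thesis
      unfolding L R coeff_D_seq coeff_smult by (simp only: eq_diff_eq add_ac)
  qed
  moreover have "lower n *\<^sub>v x = upper z n *\<^sub>v y \<longleftrightarrow> (\<forall>i\<le>l. (lower n *\<^sub>v x) $ i = (upper z n *\<^sub>v y) $ i)" for n x y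
    using lower_carrier[of n] upper_carrier[where z = z and n = n] by (auto simp: Matrix.vec_eq_iff Cmat_def Vmat_def)
  ultimately show ?thesis
    unfolding eigenfunction_def poly_eq_iff by blast
qed

lemma D_vec_index:
  assumes "P \<in> carrier_vec (l + 1)" "i \<le> l"
  shows "D_vec a b k l P $ i = D (\<lambda>i. P $ i) i"
proof -
  let ?p = "\<lambda>i. [:complex_of_real (b + 1 + 2 * real i), - of_real (a + b + real l + real i + 2):]"
  have "(first_op a b l *\<^sub>v map_vec pderiv P) $ i = ?p i * pderiv (P $ i)
     + (if i = 0 then 0 else [:of_real (real i):] * pderiv (P $ (i - 1)))"
    using assms
    by (subst mult_lower_bidiagonal[where p = ?p and q = "\<lambda>i. [:of_real (real i):]"])
       (auto simp: first_op_def const_mat_def Cmat_def Umat_def mat_diag_def)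
  moreover have "(const_mat (Vmat a b k l) *\<^sub>v P) $ i = [:of_real (real i * (a + b + real i - k + 1)):] * P $ i
     + (if i = l then 0 else [:- of_real ((real l - real i) * (real i + b - k + 1)):] * P $ (Suc i))"
    using assms
    by (subst mult_upper_bidiagonal[where p = "\<lambda>i. [:of_real (real i * (a + b + real i - k + 1)):]"
          and q = "\<lambda>i. [:- of_real ((real l - real i) * (real i + b - k + 1)):]"])
       (auto simp: const_mat_def Vmat_def)
  moreover have "D_vec a b k l P $ i = lead_op * pderiv (pderiv (P $ i))
      + (first_op a b l *\<^sub>v map_vec pderiv P) $ i - (const_mat (Vmat a b k l) *\<^sub>v P) $ i"
    using assms by (simp add: D_vec_def const_mat_def Vmat_def first_op_def Umat_def mat_diag_def numeral_2_eq_2)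
  ultimately show ?thesis
    by (cases "i = 0"; cases "i = l") (simp_all add: D_seq_def)
qed

lemma D_vec_dim: "P \<in> carrier_vec (l + 1) \<Longrightarrow> D_vec a b k l P \<in> carrier_vec (l + 1)"
  by (rule carrier_vecI) (simp add: D_vec_def const_mat_def Vmat_def)

lemma eigenspace_poly_iff:
  "P \<in> eigenspace_poly a b k l z \<longleftrightarrow> P \<in> carrier_vec (l + 1) \<and> eigenfunction z (\<lambda>i. P $ i)"
proof -
  have "D_vec a b k l P = [:z:] \<cdot>\<^sub>v P \<longleftrightarrow> eigenfunction z (\<lambda>i. P $ i)" if P: "P \<in> carrier_vec (l + 1)"
    using D_vec_dim[OF P] P D_vec_index[OF P]
    by (auto simp: Matrix.vec_eq_iff eigenfunction_def less_Suc_eq_le)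
  then show ?thesis
    by (auto simp: eigenspace_poly_def)
qed

lemma stair_iff_degree: "F \<in> stair (Suc n) 0 \<longleftrightarrow> (\<forall>i\<le>l. degree (F i) \<le> n)"
  by (auto simp: stair_def Suc_le_eq intro: degree_le) (meson coeff_eq_0 le_less_trans)

lemma eigenspace_deg_le_iff:
  "P \<in> eigenspace_deg_le a b k l z n \<longleftrightarrow>
     P \<in> carrier_vec (l + 1) \<and> eigenfunction z (\<lambda>i. P $ i) \<and> (\<lambda>i. P $ i) \<in> stair (Suc n) 0"
  by (auto simp: eigenspace_deg_le_def eigenspace_poly_iff stair_iff_degree less_Suc_eq_le)

section \<open>The inner product as an integral against the weight matrix\<close>

lemma poly_binom_tr:
  assumes "r \<le> l"
  shows "poly (binom_tr F r) x = (\<Sum>i\<le>l. of_nat (r choose i) * x ^ i * poly (F i) x)"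
proof -
  have "poly (binom_tr F r) x = (\<Sum>i\<le>r. of_nat (r choose i) * x ^ i * poly (F i) x)"
    by (simp add: binom_tr_def poly_sum poly_monom mult_ac)
  also have "\<dots> = (\<Sum>i\<le>l. of_nat (r choose i) * x ^ i * poly (F i) x)"
    using assms by (intro sum.mono_neutral_left) auto
  finally show ?thesis .
qed

text \<open>The definition of \<open>Z\<close> is a factorization through the Pascal matrix; extending the inner sums from
  \<open>r\<close> to \<open>l\<close> adds only vanishing binomial coefficients.\<close>

lemma Wmat_sum:
  assumes "u \<in> {0<..<1}"
  shows "(\<Sum>i\<le>l. \<Sum>j\<le>l. Wmat a b k l u $$ (i, j) * poly (F j) (of_real u) * poly (G i) (of_real u))
   = (\<Sum>r\<le>l. of_real (wt r) * (of_real ((1 - u) powr (a + real (l - r)) * u powr b)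
        * poly (binom_tr F r * binom_tr G r) (of_real u)))"
proof -
  let ?w = "\<lambda>r. complex_of_real (wt r * ((1 - u) powr a * u powr b * (1 - u) ^ (l - r)))"
  let ?x = "complex_of_real u"
  have W: "Wmat a b k l u $$ (i, j) = (\<Sum>r\<le>l. ?w r * (of_nat (r choose i) * ?x ^ i) * (of_nat (r choose j) * ?x ^ j))"
    if "i \<le> l" "j \<le> l" for i j
  proof -
    have "Wmat a b k l u $$ (i, j) = complex_of_real ((1 - u) powr a * u powr b * (\<Sum>r\<le>l. real (r choose i) * real (r choose j)
        * ((real l + k - real r - 1) gchoose (l - r)) * ((b - k + real r) gchoose r) * (1 - u) ^ (l - r) * u ^ (i + j)))"
      using that by (simp add: Wmat_def Zmat_def)
    also have "\<dots> = complex_of_real (\<Sum>r\<le>l. wt r * ((1 - u) powr a * u powr b * (1 - u) ^ (l - r))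
        * (real (r choose i) * u ^ i) * (real (r choose j) * u ^ j))"
      unfolding sum_distrib_left wt_def power_add by (simp only: mult_ac)
    finally show ?thesis
      by simp
  qed
  have "(\<Sum>i\<le>l. \<Sum>j\<le>l. Wmat a b k l u $$ (i, j) * poly (F j) ?x * poly (G i) ?x)
      = (\<Sum>i\<le>l. \<Sum>j\<le>l. \<Sum>r\<le>l. ?w r * ((of_nat (r choose j) * ?x ^ j * poly (F j) ?x) * (of_nat (r choose i) * ?x ^ i * poly (G i) ?x)))"
    by (intro sum.cong refl) (simp only: W atMost_iff sum_distrib_right, simp only: mult_ac)
  also have "\<dots> = (\<Sum>i\<le>l. \<Sum>r\<le>l. \<Sum>j\<le>l. ?w r * ((of_nat (r choose j) * ?x ^ j * poly (F j) ?x) * (of_nat (r choose i) * ?x ^ i * poly (G i) ?x)))"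
    by (rule sum.cong[OF refl], rule sum.swap)
  also have "\<dots> = (\<Sum>r\<le>l. \<Sum>i\<le>l. \<Sum>j\<le>l. ?w r * ((of_nat (r choose j) * ?x ^ j * poly (F j) ?x) * (of_nat (r choose i) * ?x ^ i * poly (G i) ?x)))"
    by (rule sum.swap)
  also have "\<dots> = (\<Sum>r\<le>l. ?w r * (poly (binom_tr F r) ?x * poly (binom_tr G r) ?x))"
  proof (intro sum.cong refl)
    fix r assume "r \<in> {..l}"
    then have r: "r \<le> l"
      by simp
    show "(\<Sum>i\<le>l. \<Sum>j\<le>l. ?w r * ((of_nat (r choose j) * ?x ^ j * poly (F j) ?x) * (of_nat (r choose i) * ?x ^ i * poly (G i) ?x)))
        = ?w r * (poly (binom_tr F r) ?x * poly (binom_tr G r) ?x)"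
      unfolding mult.commute[of "poly (binom_tr F r) ?x" "poly (binom_tr G r) ?x"]
      unfolding poly_binom_tr[OF r]
      unfolding sum_product
      unfolding sum_distrib_left
      by (intro sum.cong refl) (simp only: mult_ac)
  qed
  also have "\<dots> = (\<Sum>r\<le>l. of_real (wt r) * (of_real ((1 - u) powr (a + real (l - r)) * u powr b)
        * poly (binom_tr F r * binom_tr G r) ?x))"
  proof (intro sum.cong refl)
    fix r
    have "(1 - u) powr (a + real (l - r)) = (1 - u) powr a * (1 - u) ^ (l - r)"
      using assms by (simp only: powr_add) (simp only: powr_realpow greaterThanLessThan_iff diff_gt_0_iff_gt)
    then show "?w r * (poly (binom_tr F r) ?x * poly (binom_tr G r) ?x) = of_real (wt r) * (of_real ((1 - u) powr (a + real (l - r)) * u powr b)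
        * poly (binom_tr F r * binom_tr G r) ?x)"
      by simp
  qed
  finally show ?thesis .
qed

lemma hform_integral:
  "(LINT u:{0<..<1}|lborel. (\<Sum>i\<le>l. \<Sum>j\<le>l. Wmat a b k l u $$ (i, j) * poly (F j) (of_real u) * cnj (poly (G i) (of_real u))))
     = hform F G"
proof -
  let ?G = "\<lambda>i. map_poly cnj (G i)"
  let ?t = "\<lambda>r u. complex_of_real (wt r) * (of_real ((1 - u) powr (a + real (l - r)) * u powr b)
        * poly (binom_tr F r * binom_tr ?G r) (of_real u))"
  have int: "set_integrable lborel {0<..<1} (?t r)" for r
    by (intro set_integrable_mult_right jacobi_integrable exponents)
  have "(LINT u:{0<..<1}|lborel. (\<Sum>i\<le>l. \<Sum>j\<le>l. Wmat a b k l u $$ (i, j) * poly (F j) (of_real u) * cnj (poly (G i) (of_real u))))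
      = (LINT u:{0<..<1}|lborel. (\<Sum>r\<le>l. ?t r u))"
    by (rule set_lebesgue_integral_cong) (use Wmat_sum[of _ F ?G] in auto)
  also have "\<dots> = (\<Sum>r\<le>l. LINT u:{0<..<1}|lborel. ?t r u)"
    unfolding set_lebesgue_integral_def scaleR_sum_right
    by (rule Bochner_Integration.integral_sum) (rule int[unfolded set_integrable_def])
  also have "\<dots> = hform F G"
    unfolding hform_def bform_def J_def jacobi_int_def by (simp only: set_integral_mult_right)
  finally show ?thesis .
qed

lemma Wmat_symmetric: "i \<le> l \<Longrightarrow> j \<le> l \<Longrightarrow> Wmat a b k l u $$ (i, j) = Wmat a b k l u $$ (j, i)"
  by (simp add: Wmat_def Zmat_def mult_ac add_ac)

lemma Wmat_carrier: "Wmat a b k l u \<in> carrier_mat (l + 1) (l + 1)"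
  by (simp add: Wmat_def Zmat_def)

lemma orthogonal_vec_iff:
  assumes "F \<in> carrier_vec (l + 1)" "G \<in> carrier_vec (l + 1)"
  shows "orthogonal_vec a b k l F G \<longleftrightarrow> hform (\<lambda>i. F $ i) (\<lambda>i. G $ i) = 0"
proof -
  have "(Wmat a b k l u *\<^sub>v eval_vec F u) \<bullet>c eval_vec G u
      = (\<Sum>i\<le>l. \<Sum>j\<le>l. Wmat a b k l u $$ (i, j) * poly (F $ j) (of_real u) * cnj (poly (G $ i) (of_real u)))" for u
    using assms Wmat_carrier[of u]
    by (simp add: scalar_prod_def eval_vec_def sum_distrib_right atLeast0LessThan lessThan_Suc_atMost)
  then show ?thesis
    unfolding orthogonal_vec_def by (simp only: hform_integral)
qed

lemma mat_pairing_index: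
  assumes P: "P \<in> carrier_mat (l + 1) (l + 1)" and Q: "Q \<in> carrier_mat (l + 1) (l + 1)" and ij: "i \<le> l" "j \<le> l"
  shows "mat_pairing a b k l P Q $$ (i, j) = hform (\<lambda>m. P $$ (i, m)) (\<lambda>m. Q $$ (j, m))"
proof -
  have "(eval_mat P u * Wmat a b k l u * mat_adjoint (eval_mat Q u)) $$ (i, j)
      = (\<Sum>m\<le>l. \<Sum>n\<le>l. Wmat a b k l u $$ (m, n) * poly (P $$ (i, n)) (of_real u) * cnj (poly (Q $$ (j, m)) (of_real u)))" for u
  proof -
    have W: "Wmat a b k l u \<in> carrier_mat (l + 1) (l + 1)"
      by (rule Wmat_carrier)
    have PW: "(eval_mat P u * Wmat a b k l u) $$ (i, m)
        = (\<Sum>n\<le>l. Wmat a b k l u $$ (m, n) * poly (P $$ (i, n)) (of_real u))" if "m \<le> l" for m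
      using P W ij that Wmat_symmetric[of _ m u]
      by (auto simp: scalar_prod_def eval_mat_def atLeast0LessThan lessThan_Suc_atMost mult.commute intro!: sum.cong)
    have A: "mat_adjoint (eval_mat Q u) $$ (m, j) = cnj (poly (Q $$ (j, m)) (of_real u))" if "m \<le> l" for m
      using Q ij that by (simp add: mat_adjoint_def mat_of_rows_def eval_mat_def cols_def del: upt_Suc)
    have dims: "dim_row (eval_mat P u * Wmat a b k l u) = l + 1" "dim_col (eval_mat P u * Wmat a b k l u) = l + 1"
        "dim_row (mat_adjoint (eval_mat Q u)) = l + 1" "dim_col (mat_adjoint (eval_mat Q u)) = l + 1"
      using P Q W by (auto simp: mat_adjoint_def eval_mat_def)
    have "(eval_mat P u * Wmat a b k l u * mat_adjoint (eval_mat Q u)) $$ (i, j)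
      = (\<Sum>m\<le>l. (eval_mat P u * Wmat a b k l u) $$ (i, m) * mat_adjoint (eval_mat Q u) $$ (m, j))"
      using ij dims by (simp add: scalar_prod_def atLeast0LessThan lessThan_Suc_atMost del: index_mult_mat(2,3))
    then show ?thesis
      by (simp add: PW A sum_distrib_right)
  qed
  then show ?thesis
    using ij by (simp add: mat_pairing_def hform_integral)
qed

end

context jacobi_data
begin

section \<open>The constructed polynomials\<close>

text \<open>What the two cases of the construction have in common, and all that is needed of them for the
  degree, the leading coefficient and the differential equation.\<close>

definition leading_eigenvector :: "nat \<Rightarrow> nat \<Rightarrow> complex poly Matrix.vec \<Rightarrow> bool" where
  "leading_eigenvector j w P \<longleftrightarrow> P \<in> carrier_vec (l + 1)
     \<and> eigenfunction (of_real (ev j w)) (\<lambda>i. P $ i) \<and> (\<lambda>i. P $ i) \<in> stair (Suc w) 0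
     \<and> (\<exists>c. c \<noteq> 0 \<and> (\<forall>i\<le>l. coeff (P $ i) w = c * of_real (top_entry j w i)))"

lemma top_vec_eq: "top_vec a b k l j w = Matrix.vec (l + 1) (\<lambda>i. of_real (top_entry j w i))"
  unfolding top_vec_def top_entry_def ..

lemma upper_top_vec:
  assumes "j \<le> l"
  shows "upper (of_real (ev j w)) w *\<^sub>v top_vec a b k l j w = 0\<^sub>v (l + 1)"
proof (rule eq_vecI)
  show "dim_vec (upper (of_real (ev j w)) w *\<^sub>v top_vec a b k l j w) = dim_vec (0\<^sub>v (l + 1))"
    by simp
  fix i assume "i < dim_vec (0\<^sub>v (l + 1))"
  then have i: "i < l + 1"
    by simp
  have "(upper (of_real (ev j w)) w *\<^sub>v top_vec a b k l j w) $ i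
      = - of_real ((ev i w - ev j w) * top_entry j w i + (real l - real i) * (real i + b - k + 1) * top_entry j w (Suc i))"
    using i
    by (subst mult_upper_bidiagonal[OF upper_carrier _ i upper_index])
       (auto simp: top_vec_eq algebra_simps less_Suc_eq)
  then show "(upper (of_real (ev j w)) w *\<^sub>v top_vec a b k l j w) $ i = 0\<^sub>v (l + 1) $ i"
    unfolding top_entry_rec[OF assms] using i by simp
qed

lemma not_repeated_ev:
  assumes "not_repeated a b k l j w" "m \<noteq> w" "i \<le> l"
  shows "complex_of_real (ev j w) \<noteq> of_real (ev i m)"
  using assms unfolding not_repeated_def of_real_eq_iff by (metis fst_conv)

text \<open>The power series solves the equation by its recursion, and it terminates: the factor \<open>upper\<close> at degree
  \<open>w\<close> annihilates the prescribed coefficient.\<close>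

lemma simple_leading_eigenvector:
  assumes j: "j \<le> l" and P: "constructed_simple a b k l j w P"
  shows "leading_eigenvector j w P"
proof -
  let ?z = "complex_of_real (ev j w)"
  from P obtain F0 where F0: "F0 \<in> carrier_vec (l + 1)" "cuv ?z w *\<^sub>v F0 = top_vec a b k l j w"
    and car: "P \<in> carrier_vec (l + 1)"
    and co: "\<And>i. coeff_vec P i = inverse (fact i) \<cdot>\<^sub>v (cuv ?z i *\<^sub>v F0)"
    unfolding constructed_simple_def Let_def coeff_vec_def by blast
  have cF: "cuv ?z n *\<^sub>v F0 \<in> carrier_vec (l + 1)" for n
    by (rule mult_mat_vec_carrier[OF cuv_carrier F0(1)])
  have "eigenfunction ?z (\<lambda>i. P $ i)"
    unfolding eigenfunction_iff_rec[OF car]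
  proof
    fix n
    have "of_nat (Suc n) \<cdot>\<^sub>v coeff_vec P (Suc n) = inverse (fact n) \<cdot>\<^sub>v (cuv ?z (Suc n) *\<^sub>v F0)"
    proof -
      have "of_nat (Suc n) * inverse (fact (Suc n)) = (inverse (fact n) :: complex)"
        by (simp add: fact_Suc divide_simps del: of_nat_Suc)
      then show ?thesis
        unfolding co smult_smult_assoc by (simp only:)
    qed
    then show "lower n *\<^sub>v (of_nat (Suc n) \<cdot>\<^sub>v coeff_vec P (Suc n)) = upper ?z n *\<^sub>v coeff_vec P n"
      unfolding co
      by (simp only: mult_mat_vec[OF lower_carrier cF] mult_mat_vec[OF upper_carrier cF] lower_cuv_Suc[OF F0(1)])
  qed
  moreover have kill: "A *\<^sub>v 0\<^sub>v (l + 1) = 0\<^sub>v (l + 1)" if "A \<in> carrier_mat (l + 1) (l + 1)" for A :: "complex mat"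
    using that by (intro eq_vecI) auto
  have zero: "cuv ?z (Suc w + n) *\<^sub>v F0 = 0\<^sub>v (l + 1)" for n
  proof (induction n)
    case 0
    show ?case
      using kill[OF mat_inverse_of_det_nz(1)[OF lower_carrier lower_det]]
      by (simp only: add_0_right cuv_Suc_vec[OF F0(1)] F0(2) upper_top_vec[OF j])
  next
    case (Suc n)
    show ?case
      by (simp only: add_Suc_right cuv_Suc_vec[OF F0(1)] Suc.IH kill[OF upper_carrier]
          kill[OF mat_inverse_of_det_nz(1)[OF lower_carrier lower_det]])
  qed
  have coe: "coeff (P $ i) n = inverse (fact n) * (cuv ?z n *\<^sub>v F0) $ i" if "i \<le> l" for i n
    using arg_cong[OF co[of n], of "\<lambda>v. v $ i"] that car carrier_vecD[OF cF[of n]] by (simp add: coeff_vec_def)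
  have "(\<lambda>i. P $ i) \<in> stair (Suc w) 0"
    unfolding stair_def
  proof (intro CollectI allI impI)
    fix i m assume "i \<le> l" "if i < 0 then Suc w < m else Suc w \<le> m"
    then show "coeff (P $ i) m = 0"
      using coe[of i m] zero[of "m - Suc w"] by simp
  qed
  moreover have "coeff (P $ i) w = inverse (fact w) * of_real (top_entry j w i)" if "i \<le> l" for i
    unfolding coe[OF that] F0(2) top_vec_eq using that by simp
  then have "\<exists>c. c \<noteq> 0 \<and> (\<forall>i\<le>l. coeff (P $ i) w = c * of_real (top_entry j w i))"
    by (intro exI[of _ "inverse (fact w)"]) auto
  ultimately show ?thesis
    unfolding leading_eigenvector_def using car by blast
qed

text \<open>The coefficients of an eigenfunction obey the recursion, hence its value at \<open>0\<close> is a solution \<open>F0\<close>.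
  The scaling by \<open>1 / w!\<close> is that of the power series. Uniqueness of \<open>F0\<close> is \<open>cuv_det\<close>.\<close>

lemma simple_exists:
  assumes j: "j \<le> l" and nr: "not_repeated a b k l j w"
  shows "\<exists>P. constructed_simple a b k l j w P"
proof -
  let ?z = "complex_of_real (ev j w)"
  obtain F where F: "eigenfunction ?z F" "\<And>i. i \<le> l \<Longrightarrow> coeff (F i) w = of_real (top_entry j w i)"
    using eigenfunction_exists[OF j, of w] by blast
  define P where "P = Matrix.vec (l + 1) (\<lambda>i. smult (inverse (fact w)) (F i))"
  have car: "P \<in> carrier_vec (l + 1)"
    by (simp add: P_def)
  have "eigenfunction ?z (\<lambda>i. P $ i)"
    unfolding eigenfunction_def
  proof (intro allI impI)
    fix i assume i: "i \<le> l"
    have "coeff (D (\<lambda>i. P $ i) i) n = inverse (fact w) * coeff (D F i) n" for n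
    proof -
      have "of_real ((real l - real i) * (real i + b - k + 1)) * coeff (P $ (Suc i)) n
        = inverse (fact w) * (of_real ((real l - real i) * (real i + b - k + 1)) * coeff (F (Suc i)) n)"
        using i by (cases "i = l") (auto simp: P_def)
      then show ?thesis
        using i unfolding coeff_D_seq by (simp add: P_def algebra_simps del: of_real_mult of_real_diff of_real_add)
    qed
    then show "D (\<lambda>i. P $ i) i = smult ?z (P $ i)"
      using F(1) i unfolding eigenfunction_def by (intro poly_eqI) (simp add: P_def)
  qed
  then have rec: "lower n *\<^sub>v (of_nat (Suc n) \<cdot>\<^sub>v coeff_vec P (Suc n)) = upper ?z n *\<^sub>v coeff_vec P n" for n
    using eigenfunction_iff_rec[OF car] by blast
  let ?F0 = "coeff_vec P 0"
  have F0: "?F0 \<in> carrier_vec (l + 1)"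
    by (rule coeff_vec_carrier[OF car])
  have cF: "cuv ?z n *\<^sub>v ?F0 \<in> carrier_vec (l + 1)" for n
    by (rule mult_mat_vec_carrier[OF cuv_carrier F0])
  have cuv: "cuv ?z n *\<^sub>v ?F0 = fact n \<cdot>\<^sub>v coeff_vec P n" for n
  proof (induction n)
    case 0
    show ?case
      using F0 by simp
  next
    case (Suc n)
    have "lower n *\<^sub>v (cuv ?z (Suc n) *\<^sub>v ?F0) = lower n *\<^sub>v (fact (Suc n) \<cdot>\<^sub>v coeff_vec P (Suc n))"
    proof -
      have "lower n *\<^sub>v (cuv ?z (Suc n) *\<^sub>v ?F0) = upper ?z n *\<^sub>v (fact n \<cdot>\<^sub>v coeff_vec P n)"
        unfolding lower_cuv_Suc[OF F0] Suc.IH ..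
      also have "\<dots> = lower n *\<^sub>v (fact n \<cdot>\<^sub>v (of_nat (Suc n) \<cdot>\<^sub>v coeff_vec P (Suc n)))"
        unfolding mult_mat_vec[OF upper_carrier coeff_vec_carrier[OF car]] rec[symmetric]
        by (rule mult_mat_vec[OF lower_carrier, symmetric]) (simp add: coeff_vec_carrier[OF car, simplified])
      finally show ?thesis
        unfolding smult_smult_assoc by (simp only: fact_Suc mult.commute)
    qed
    then show ?case
      by (rule mult_mat_vec_inj_of_det_nz[OF lower_carrier lower_det cF, rotated])
         (simp add: coeff_vec_carrier[OF car, simplified])
  qed
  have top: "cuv ?z w *\<^sub>v ?F0 = top_vec a b k l j w"
    unfolding cuv by (rule eq_vecI) (auto simp: coeff_vec_def P_def top_vec_eq F(2) less_Suc_eq_le)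
  have "Determinant.det (cuv ?z w) \<noteq> 0"
    by (rule cuv_det, rule not_repeated_ev[OF nr]) auto
  then have "cuv ?z w *\<^sub>v F' = top_vec a b k l j w \<longleftrightarrow> F' = ?F0" if "F' \<in> carrier_vec (l + 1)" for F'
    using mult_mat_vec_inj_of_det_nz[OF cuv_carrier _ that F0] top by metis
  moreover have "coeff_vec P i = inverse (fact i) \<cdot>\<^sub>v (cuv ?z i *\<^sub>v ?F0)" for i
    unfolding cuv smult_smult_assoc by simp
  ultimately have "constructed_simple a b k l j w P"
    unfolding constructed_simple_def Let_def coeff_vec_def[symmetric] using F0 car by blast
  then show ?thesis ..
qed

text \<open>Each \<open>j\<close> has at most one degree with the given eigenvalue, so the pairs are finitely many; and each
  degree has at most one \<open>j\<close>, so that sorting by degree lists them all.\<close>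

lemma pairs_listing:
  assumes "j \<le> l"
  shows "\<exists>ps r. set ps = {(w', j'). j' \<le> l \<and> ev j' w' = ev j w} \<and> sorted_wrt (<) (map fst ps) \<and> r < length ps \<and> ps ! r = (w, j)"
proof -
  define S where "S = {(w', j'). j' \<le> l \<and> ev j' w' = ev j w}"
  have "inj_on snd S"
    by (rule inj_onI) (auto simp: S_def, metis ev_inj_degree)
  moreover have "snd ` S \<subseteq> {..l}"
    by (auto simp: S_def)
  ultimately have fin: "finite S"
    by (meson finite_atMost finite_imageD finite_subset)
  have inj: "inj_on fst S"
    by (rule inj_onI) (auto simp: S_def, metis ev_inj)
  define ps where "ps = map (the_inv_into S fst) (sorted_list_of_set (fst ` S))"
  have "set ps = the_inv_into S fst ` fst ` S"
    using fin by (simp add: ps_def)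
  also have "\<dots> = S"
    using inj by (simp add: image_image the_inv_into_f_f cong: image_cong)
  finally have set: "set ps = S" .
  have "map fst ps = map (\<lambda>x. x) (sorted_list_of_set (fst ` S))"
    unfolding ps_def map_map using fin inj by (intro map_cong refl) (auto simp: f_the_inv_into_f)
  then have "sorted_wrt (<) (map fst ps)"
    using strict_sorted_list_of_set by simp
  moreover have "(w, j) \<in> set ps"
    unfolding set S_def using assms by simp
  then obtain r where "r < length ps" "ps ! r = (w, j)"
    by (auto simp: in_set_conv_nth)
  ultimately show ?thesis
    using set unfolding S_def by blast
qed

lemma stair_mono: "n \<le> m \<Longrightarrow> F \<in> stair n 0 \<Longrightarrow> F \<in> stair m 0"
  by (auto simp: stair_def)

lemma sorted_nth_less_iff:
  fixes ps :: "(nat \<times> nat) list"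
  assumes "sorted_wrt (<) (map fst ps)" "q < length ps" "r < length ps"
  shows "fst (ps ! q) < fst (ps ! r) \<longleftrightarrow> q < r"
  using assms sorted_wrt_iff_nth_less[of "(<)" "map fst ps"]
  by (metis length_map less_asym linorder_neqE_nat nth_map order_less_irrefl)

text \<open>The eigenfunction obtained by projection is orthogonal to everything of lower degree, in particular
  to the previous space of the filtration.\<close>

lemma repeated_exists:
  assumes j: "j \<le> l"
  shows "\<exists>P. constructed_repeated a b k l j w P"
proof -
  let ?z = "complex_of_real (ev j w)"
  obtain ps r where ps: "set ps = {(w', j'). j' \<le> l \<and> ev j' w' = ev j w}" "sorted_wrt (<) (map fst ps)"
      "r < length ps" "ps ! r = (w, j)"
    using pairs_listing[OF j] by blast
  obtain F where F: "eigenfunction ?z F" "F \<in> stair (Suc w) 0"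
      "\<And>i. i \<le> l \<Longrightarrow> coeff (F i) w = of_real (top_entry j w i)" "\<And>Q. Q \<in> stair w 0 \<Longrightarrow> hform F Q = 0"
    using eigenfunction_exists[OF j, of w] by blast
  define P where "P = Matrix.vec (l + 1) F"
  have P: "P $ i = F i" if "i \<le> l" for i
    using that by (simp add: P_def)
  have car: "P \<in> carrier_vec (l + 1)"
    by (simp add: P_def)
  have "D (\<lambda>i. P $ i) i = D F i" if "i \<le> l" for i
  proof (rule poly_eqI)
    fix n
    have "of_real ((real l - real i) * (real i + b - k + 1)) * coeff (P $ (Suc i)) n
        = of_real ((real l - real i) * (real i + b - k + 1)) * coeff (F (Suc i)) n"
      using that P[of "Suc i"] by (cases "i = l") auto
    then show "coeff (D (\<lambda>i. P $ i) i) n = coeff (D F i) n"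
      unfolding coeff_D_seq using that P[of i] P[of "i - 1"] by simp
  qed
  then have "eigenfunction ?z (\<lambda>i. P $ i)"
    using F(1) P by (simp add: eigenfunction_def)
  moreover have "(\<lambda>i. P $ i) \<in> stair (Suc w) 0"
    using F(2) P by (simp add: stair_def)
  ultimately have mem: "P \<in> eigenspace_deg_le a b k l ?z w"
    unfolding eigenspace_deg_le_iff using car by blast
  have "P $ j \<noteq> 0"
    using F(3)[OF j] P[OF j] by auto
  then have nz: "P \<noteq> 0\<^sub>v (l + 1)"
    using j by auto
  have orth: "orthogonal_vec a b k l P Q"
    if Q: "Q \<in> carrier_vec (l + 1)" "(\<lambda>i. Q $ i) \<in> stair w 0" for Q
    unfolding orthogonal_vec_iff[OF car Q(1)]
    using F(4)[OF Q(2)] hform_cong[of "\<lambda>i. P $ i" F "\<lambda>i. Q $ i"] P by simp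
  have "\<forall>Q\<in>(if r = 0 then {0\<^sub>v (l + 1)} else eigenspace_deg_le a b k l ?z (fst (ps ! (r - 1)))). orthogonal_vec a b k l P Q"
  proof (cases "r = 0")
    case True
    have "orthogonal_vec a b k l P (0\<^sub>v (l + 1))"
      by (rule orth) (auto simp: stair_def)
    then show ?thesis
      using True by simp
  next
    case False
    then have "fst (ps ! (r - 1)) < w"
      using sorted_nth_less_iff[OF ps(2), of "r - 1" r] ps(3,4) by simp
    then show ?thesis
      using False orth stair_mono[of "Suc (fst (ps ! (r - 1)))" w] by (auto simp: eigenspace_deg_le_iff)
  qed
  then have "constructed_repeated a b k l j w P"
    unfolding constructed_repeated_def Let_def using ps mem nz
    by (intro exI[of _ ps] exI[of _ r]) auto
  then show ?thesis ..
qed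

text \<open>A smaller degree in the list precedes \<open>w\<close>, so it is at most that of the immediate predecessor, and
  \<open>Q\<close> lies in the space to which \<open>P\<close> is orthogonal by construction.\<close>

lemma repeated_orthogonal:
  assumes P: "constructed_repeated a b k l j w P" and Q: "Q \<in> carrier_vec (l + 1)"
    "eigenfunction (of_real (ev j w)) (\<lambda>i. Q $ i)" "(\<lambda>i. Q $ i) \<in> stair (Suc n) 0"
    and n: "j' \<le> l" "ev j' n = ev j w" "n < w"
  shows "hform (\<lambda>i. P $ i) (\<lambda>i. Q $ i) = 0"
proof -
  let ?z = "complex_of_real (ev j w)"
  from P obtain ps r where ps: "set ps = {(w', j'). j' \<le> l \<and> ev j' w' = ev j w}"
      "sorted_wrt (<) (map fst ps)" "r < length ps" "ps ! r = (w, j)"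
    and mem: "P \<in> eigenspace_deg_le a b k l ?z w"
    and orth: "\<And>Q. Q \<in> (if r = 0 then {0\<^sub>v (l + 1)} else eigenspace_deg_le a b k l ?z (fst (ps ! (r - 1))))
       \<Longrightarrow> orthogonal_vec a b k l P Q"
    unfolding constructed_repeated_def Let_def by auto
  have "(n, j') \<in> set ps"
    unfolding ps(1) using n by simp
  then obtain q where q: "q < length ps" "ps ! q = (n, j')"
    by (auto simp: in_set_conv_nth)
  have qr: "q < r"
    using sorted_nth_less_iff[OF ps(2) q(1) ps(3)] q(2) ps(4) n(3) by simp
  have "r - 1 < length ps"
    using ps(3) by simp
  then have "n \<le> fst (ps ! (r - 1))"
    using sorted_nth_less_iff[OF ps(2) _ q(1), of "r - 1"] qr q(2) by (cases "fst (ps ! (r - 1)) < n") auto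
  then have "Q \<in> eigenspace_deg_le a b k l ?z (fst (ps ! (r - 1)))"
    using Q stair_mono[of "Suc n" "Suc (fst (ps ! (r - 1)))"] unfolding eigenspace_deg_le_iff by simp
  then have "orthogonal_vec a b k l P Q"
    using orth qr by simp
  moreover have "P \<in> carrier_vec (l + 1)"
    using mem by (simp only: eigenspace_deg_le_iff)
  ultimately show ?thesis
    using orthogonal_vec_iff Q(1) by blast
qed

text \<open>If the coefficient of \<open>u\<^sup>w\<close> vanished, the degree of \<open>P\<close> would be a smaller number \<open>m\<close>, and the
  eigenvalue would also be one of degree \<open>m\<close>. Then \<open>repeated_orthogonal\<close> applies with \<open>Q = P\<close>.\<close>

lemma repeated_leading_eigenvector:
  assumes j: "j \<le> l" and P: "constructed_repeated a b k l j w P"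
  shows "leading_eigenvector j w P"
proof -
  let ?z = "complex_of_real (ev j w)" and ?P = "\<lambda>i. P $ i"
  from P have "P \<in> eigenspace_deg_le a b k l ?z w" and nz: "P \<noteq> 0\<^sub>v (l + 1)"
    unfolding constructed_repeated_def Let_def by auto
  then have eig: "P \<in> carrier_vec (l + 1)" "eigenfunction ?z ?P" "?P \<in> stair (Suc w) 0"
    by (simp_all only: eigenspace_deg_le_iff)
  have top: "coeff (P $ i) w = coeff (P $ j) w * of_real (top_entry j w i)" if "i \<le> l" for i
    using top_coeff_proportional[OF eig(2,3) j that] .
  have "coeff (P $ j) w \<noteq> 0"
  proof
    assume "coeff (P $ j) w = 0"
    then have "coeff (P $ i) w = 0" if "i \<le> l" for i
      using top[OF that] by simp
    then have "?P \<in> stair w 0"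
      using eig(3) by (auto simp: stair_def) (metis le_antisym not_less_eq_eq)
    define n where "n = (LEAST n. ?P \<in> stair n 0)"
    have n: "?P \<in> stair n 0" "n \<le> w"
      unfolding n_def using \<open>?P \<in> stair w 0\<close> by (auto intro: LeastI Least_le)
    have "?P \<notin> stair 0 0"
      using nz eig(1) by (auto simp: stair_def poly_eq_iff Matrix.vec_eq_iff less_Suc_eq_le)
    with n obtain m where m: "n = Suc m"
      by (cases n) auto
    have "?P \<notin> stair m 0"
      using not_less_Least[of m "\<lambda>n. ?P \<in> stair n 0"] m unfolding n_def by simp
    then obtain j' where "j' \<le> l" "?z = of_real (ev j' m)"
      using eigenvalue_from_degree[OF eig(2)] n(1) unfolding m by blast
    then have "hform ?P ?P = 0"
      using n m by (intro repeated_orthogonal[OF P eig(1,2), of m j']) auto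
    then have "P $ i = 0" if "i \<le> l" for i
      using hform_definite that by blast
    then show False
      using nz eig(1) by (auto simp: Matrix.vec_eq_iff less_Suc_eq_le)
  qed
  then show ?thesis
    unfolding leading_eigenvector_def using eig top by blast
qed

lemma family_leading_eigenvector:
  assumes "constructed_family a b k l p" "j \<le> l"
  shows "leading_eigenvector j w (p w j)"
  using assms simple_leading_eigenvector repeated_leading_eigenvector
  unfolding constructed_family_def by meson

lemma family_orthogonal_less:
  assumes p: "constructed_family a b k l p" and j: "j \<le> l" "j' \<le> l" and w: "w' < w"
  shows "hform (\<lambda>i. p w j $ i) (\<lambda>i. p w' j' $ i) = 0"
proof -
  have P: "leading_eigenvector j w (p w j)" and Q: "leading_eigenvector j' w' (p w' j')"
    using family_leading_eigenvector[OF p] j by blast+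
  show ?thesis
  proof (cases "ev j' w' = ev j w")
    case False
    then show ?thesis
      using P Q unfolding leading_eigenvector_def by (intro eigenfunctions_orthogonal[of "ev j w" _ "ev j' w'"]) auto
  next
    case True
    then have "\<not> not_repeated a b k l j w"
      unfolding not_repeated_def using j w by auto
    then have "constructed_repeated a b k l j w (p w j)"
      using p j unfolding constructed_family_def by meson
    then show ?thesis
      using Q True j w unfolding leading_eigenvector_def by (intro repeated_orthogonal[of j w _ _ w' j']) auto
  qed
qed

lemma family_orthogonal:
  assumes p: "constructed_family a b k l p" and j: "j \<le> l" "j' \<le> l" and w: "w \<noteq> w'"
  shows "hform (\<lambda>i. p w j $ i) (\<lambda>i. p w' j' $ i) = 0"
proof (cases "w' < w")
  case True
  then show ?thesis
    using family_orthogonal_less[OF p] j by blast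
next
  case False
  then have "hform (\<lambda>i. p w' j' $ i) (\<lambda>i. p w j $ i) = 0"
    using family_orthogonal_less[OF p] j w by simp
  then show ?thesis
    using hform_cnj by (metis complex_cnj_zero)
qed

lemma family_exists: "\<exists>p. constructed_family a b k l p"
proof -
  have "\<forall>w j. \<exists>P. j \<le> l \<longrightarrow> (if not_repeated a b k l j w then constructed_simple a b k l j w P
      else constructed_repeated a b k l j w P)"
    using simple_exists repeated_exists by metis
  then show ?thesis
    unfolding constructed_family_def by metis
qed

section \<open>The matrix valued polynomials\<close>

lemma mat_with_rows_index: "j \<le> l \<Longrightarrow> i \<le> l \<Longrightarrow> mat_with_rows l v $$ (j, i) = v j $ i"
  by (simp add: mat_with_rows_def mat_of_rows_def del: upt_Suc)

lemma mat_with_rows_carrier: "mat_with_rows l v \<in> carrier_mat (l + 1) (l + 1)"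
  by (simp add: mat_with_rows_def mat_of_rows_def)

lemma family_orthogonal_sequence:
  assumes p: "constructed_family a b k l p"
  shows "orthogonal_sequence a b k l (\<lambda>w. mat_with_rows l (p w))"
  unfolding orthogonal_sequence_def
proof (intro conjI allI impI)
  fix w
  let ?M = "mat_with_rows l (p w)" and ?L = "coeff_mat (mat_with_rows l (p w)) w"
  show "?M \<in> carrier_mat (l + 1) (l + 1)"
    by (rule mat_with_rows_carrier)
  have car: "coeff_mat ?M n \<in> carrier_mat (l + 1) (l + 1)" for n
    using mat_with_rows_carrier by (simp add: coeff_mat_def)
  have idx: "coeff_mat ?M n $$ (j, i) = coeff (p w j $ i) n" if "j \<le> l" "i \<le> l" for n j i
    using that mat_with_rows_carrier[of "p w"] by (simp add: coeff_mat_def mat_with_rows_index)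
  obtain c where c: "\<And>j. j \<le> l \<Longrightarrow> c j \<noteq> 0" "\<And>j i. j \<le> l \<Longrightarrow> i \<le> l \<Longrightarrow> ?L $$ (j, i) = c j * of_real (top_entry j w i)"
  proof -
    have "\<forall>j. \<exists>c. j \<le> l \<longrightarrow> c \<noteq> 0 \<and> (\<forall>i\<le>l. ?L $$ (j, i) = c * of_real (top_entry j w i))"
      using family_leading_eigenvector[OF p, of _ w] unfolding leading_eigenvector_def by (metis idx)
    then show ?thesis
      using that by metis
  qed
  have det: "Determinant.det ?L \<noteq> 0"
    by (rule det_lower_triangular_nz[OF car]) (auto simp: c top_entry_def less_Suc_eq_le)
  show "invertible_mat ?L"
    using mat_inverse_of_det_nz[OF car det] car[of w] unfolding invertible_mat_def inverts_mat_def by auto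
  show "has_degree_mat l ?M w"
    unfolding has_degree_mat_def
  proof (intro conjI allI impI)
    show "?L \<noteq> 0\<^sub>m (l + 1) (l + 1)"
      using c(1)[of 0] c(2)[of 0 0] by auto
    fix n assume "w < n"
    then have "coeff (p w j $ i) n = 0" if "j \<le> l" "i \<le> l" for j i
      using family_leading_eigenvector[OF p that(1), of w] that unfolding leading_eigenvector_def by (auto simp: stair_def Suc_le_eq)
    then show "coeff_mat ?M n = 0\<^sub>m (l + 1) (l + 1)"
      using car[of n] by (intro eq_matI) (auto simp: idx less_Suc_eq_le)
  qed
next
  fix w w' :: nat assume w: "w \<noteq> w'"
  show "mat_pairing a b k l (mat_with_rows l (p w)) (mat_with_rows l (p w')) = 0\<^sub>m (l + 1) (l + 1)"
  proof (rule eq_matI)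
    fix i j assume "i < dim_row (0\<^sub>m (l + 1) (l + 1) :: complex mat)" "j < dim_col (0\<^sub>m (l + 1) (l + 1) :: complex mat)"
    then have ij: "i \<le> l" "j \<le> l"
      by auto
    have "mat_pairing a b k l (mat_with_rows l (p w)) (mat_with_rows l (p w')) $$ (i, j)
        = hform (\<lambda>m. mat_with_rows l (p w) $$ (i, m)) (\<lambda>m. mat_with_rows l (p w') $$ (j, m))"
      by (rule mat_pairing_index[OF mat_with_rows_carrier mat_with_rows_carrier ij])
    also have "\<dots> = hform (\<lambda>m. p w i $ m) (\<lambda>m. mat_with_rows l (p w') $$ (j, m))"
      by (rule hform_cong) (simp add: mat_with_rows_index ij)
    also have "\<dots> = hform (\<lambda>m. p w i $ m) (\<lambda>m. p w' j $ m)"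
      by (rule hform_cong_right) (simp add: mat_with_rows_index ij)
    also have "\<dots> = 0"
      by (rule family_orthogonal[OF p ij w])
    finally show "mat_pairing a b k l (mat_with_rows l (p w)) (mat_with_rows l (p w')) $$ (i, j) = 0\<^sub>m (l + 1) (l + 1) $$ (i, j)"
      using ij by simp
  qed (simp_all add: mat_pairing_def)
qed

lemma D_mat_index:
  assumes "M \<in> carrier_mat (l + 1) (l + 1)" "i \<le> l" "j \<le> l"
  shows "D_mat a b k l M $$ (i, j) = D (\<lambda>m. col M j $ m) i"
proof -
  have car: "first_op a b l \<in> carrier_mat (l + 1) (l + 1)" "const_mat (Vmat a b k l) \<in> carrier_mat (l + 1) (l + 1)"
    by (auto intro!: carrier_matI simp: const_mat_def Vmat_def first_op_def Umat_def mat_diag_def)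
  have mult: "(A * B) $$ (i, j) = (A *\<^sub>v col B j) $ i"
    if "A \<in> carrier_mat (l + 1) (l + 1)" "B \<in> carrier_mat (l + 1) (l + 1)" for A B :: "complex poly mat"
    using that assms by simp
  have "D_mat a b k l M $$ (i, j) = lead_op * (pderiv ^^ 2) (M $$ (i, j))
      + (first_op a b l * map_mat pderiv M) $$ (i, j) - (const_mat (Vmat a b k l) * M) $$ (i, j)"
    using assms car by (simp add: D_mat_def del: index_mult_mat(1))
  also have "\<dots> = lead_op * (pderiv ^^ 2) (M $$ (i, j))
      + (first_op a b l *\<^sub>v map_vec pderiv (col M j)) $ i - (const_mat (Vmat a b k l) *\<^sub>v col M j) $ i"
    using assms car by (simp add: mult del: index_mult_mat(1) index_mult_mat_vec)
  also have "\<dots> = D_vec a b k l (col M j) $ i"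
    using assms car by (simp add: D_vec_def del: index_mult_mat_vec)
  finally have "D_mat a b k l M $$ (i, j) = D_vec a b k l (col M j) $ i" .
  moreover have "D_vec a b k l (col M j) $ i = D (\<lambda>m. col M j $ m) i"
    using assms by (intro D_vec_index carrier_vecI) simp_all
  ultimately show ?thesis
    by (simp only:)
qed

text \<open>Conjugation of the coefficients commutes with the operator and the eigenvalues are real, so the
  conjugated rows satisfy the same equation as the rows.\<close>

lemma family_eigen_matrix:
  assumes p: "constructed_family a b k l p"
  shows "D_mat a b k l (poly_adjoint (mat_with_rows l (p w)))
     = poly_adjoint (mat_with_rows l (p w)) * const_mat (Lambda_mat a b k l w)"
proof (rule eq_matI)
  let ?M = "mat_with_rows l (p w)" and ?A = "poly_adjoint (mat_with_rows l (p w))"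
  have A: "?A \<in> carrier_mat (l + 1) (l + 1)"
    using mat_with_rows_carrier by (simp add: poly_adjoint_def)
  have idx: "?A $$ (i, j) = map_poly cnj (p w j $ i)" if "i \<le> l" "j \<le> l" for i j
    using that mat_with_rows_carrier[of "p w"] by (simp add: poly_adjoint_def mat_with_rows_index)
  have L: "const_mat (Lambda_mat a b k l w) = mat_diag (l + 1) (\<lambda>j. [:of_real (ev j w):])"
    by (rule eq_matI) (auto simp: const_mat_def Lambda_mat_def mat_diag_def)
  fix i j assume "i < dim_row (?A * const_mat (Lambda_mat a b k l w))" "j < dim_col (?A * const_mat (Lambda_mat a b k l w))"
  then have ij: "i \<le> l" "j \<le> l"
    using A by (auto simp: L mat_diag_def)
  have "D_mat a b k l ?A $$ (i, j) = D (\<lambda>m. col ?A j $ m) i"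
    by (rule D_mat_index[OF A ij])
  also have "\<dots> = D (\<lambda>m. map_poly cnj (p w j $ m)) i"
  proof (rule poly_eqI)
    fix n
    have "col ?A j $ m = map_poly cnj (p w j $ m)" if "m \<le> l" for m
      using A that ij idx[OF that ij(2)] by simp
    from this[of i] this[of "i - 1"] this[of "Suc i"]
    show "coeff (D (\<lambda>m. col ?A j $ m) i) n = coeff (D (\<lambda>m. map_poly cnj (p w j $ m)) i) n"
      unfolding coeff_D_seq using ij by (cases "i = l") auto
  qed
  also have "\<dots> = map_poly cnj (D (\<lambda>m. p w j $ m) i)"
    by (rule D_seq_cnj)
  also have "\<dots> = map_poly cnj (smult (of_real (ev j w)) (p w j $ i))"
    using family_leading_eigenvector[OF p ij(2), of w] ij unfolding leading_eigenvector_def eigenfunction_def by simp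
  also have "\<dots> = ?A $$ (i, j) * [:of_real (ev j w):]"
    unfolding idx[OF ij] by (rule poly_ext) simp
  also have "\<dots> = (?A * const_mat (Lambda_mat a b k l w)) $$ (i, j)"
    unfolding L mat_diag_mult_right[OF A] using ij by simp
  finally show "D_mat a b k l ?A $$ (i, j) = (?A * const_mat (Lambda_mat a b k l w)) $$ (i, j)" .
qed (simp_all add: D_mat_def const_mat_def Vmat_def Lambda_mat_def poly_adjoint_def mat_diag_def
    carrier_matD[OF mat_with_rows_carrier])

end

theorem theorem2p4:
  fixes \<alpha> \<beta> k :: real and l :: nat
  assumes "\<alpha> > -1" and "\<beta> > -1" and "0 < k" and "k < \<beta> + 1" and "l \<ge> 1"
  shows "(\<exists>p. constructed_family \<alpha> \<beta> k l p)
    \<and> (\<forall>p. constructed_family \<alpha> \<beta> k l p \<longrightarrow>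
         (let P = (\<lambda>w. mat_with_rows l (p w)) in
            orthogonal_sequence \<alpha> \<beta> k l P
            \<and> (\<forall>w. D_mat \<alpha> \<beta> k l (poly_adjoint (P w))
                     = poly_adjoint (P w) * const_mat (Lambda_mat \<alpha> \<beta> k l w))))"
proof -
  interpret jacobi_data \<alpha> \<beta> k l
    by unfold_locales (use assms in auto)
  show ?thesis
    using family_exists family_orthogonal_sequence family_eigen_matrix by (auto simp: Let_def)
qed

end
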